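(* Let $V[p,q]$ be the restriction to $[p,q]$ (where $1\le p\le q\le n$) of a finite-dimensional zigzag module $V$ of length $n$ over a field $K$, with a fixed interval decomposition, and let $U=I[p,q]$. (1) Every monomorphism $U\to V[p,q]$ splits if and only if $V[p,q]$ contains no breaker chain spanning $[p,q]$. (2) Both a splitting and a nonsplitting monomorphism $U\to V[p,q]$ exist if and only if $V[p,q]$ has a direct summand isomorphic to $U$ and also contains a breaker chain spanning $[p,q]$. (3) There exists at least one monomorphism $U\to V[p,q]$, and every such monomorphism is nonsplitting, if and only if $V[p,q]$ contains a breaker chain spanning $[p,q]$ but has no direct summand isomorphic to $U$.
   Context: Let $K$ be a field. A zigzag module $V$ of length $n$ over $K$ consists of finite-dimensional $K$-vector spaces $V_1,\dots,V_n$ together with, for each $1\le i<n$, exactly one linear map, either $V_i\to V_{i+1}$ (a forward arrow) or $V_i\leftarrow V_{i+1}$ (a backward arrow). The sequence of arrow directions is the zigzag type; it is fixed and all modules compared have the same type. Morphisms are families of linear maps commuting with the structure maps; a monomorphism is a morphism that is injective at every vertex. A monomorphism splits if it admits a retraction, equivalently if its image is a direct summand; otherwise it is nonsplitting. For $p\le q$, the restriction $V[p,q]$ keeps only the vector spaces and arrows with indices between $p$ and $q$. Intervals $[b,d]$ are discrete (sets of integers). The interval module $I[b,d]$ (support $[b,d]$) has $I[b,d]_i=K$ for $b\le i\le d$ and $0$ otherwise, with identity maps between consecutive nonzero spaces and zero maps otherwise. A submodule $W\subseteq V$ is a family of subspaces preserved by all structure maps; it is a direct summand if $V=W\oplus W'$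 for some submodule $W'$. An interval decomposition of $V[p,q]$ is a finite direct sum decomposition $V[p,q]=\bigoplus_{\alpha\in A}J_\alpha$ into submodules each isomorphic to an interval module $I[b,d]$ with $p\le b\le d\le q$; the $J_\alpha$ are the interval summands. "$V[p,q]$ contains a breaker chain" means that the interval summands of its fixed interval decomposition contain one. Breaker pair: an ordered pair $(J_1,J_2)$ of interval summands with $J_1\cong I[b_1,d_1]$, $J_2\cong I[b_2,d_2]$ is a breaker pair if $b_1<b_2\le d_1<d_2$, the arrow between $b_2-1$ and $b_2$ is backward, $V_{b_2-1}\leftarrow V_{b_2}$, and the arrow between $d_1$ and $d_1+1$ is forward, $V_{d_1}\to V_{d_1+1}$. Breaker chain: a sequence of interval summands $J_1,\dots,J_r$ with $r\ge 2$ such that $(J_j,J_{j+1})$ is a breaker pair for every $1\le j<r$. Writing $J_j\cong I[b_j,d_j]$, the chain spans $[p,q]$ if $b_1=p$ and $d_r=q$. *)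

theory Defs
  imports "HOL-Algebra.Module" "HOL-Algebra.AbelCoset"
begin

section \<open>Linear algebra over a field \<open>K\<close>\<close>

text \<open>A \<open>K\<close>-vector space is a \<^locale>\<open>module\<close> over a \<^locale>\<open>field\<close> \<open>K\<close>. The ring-specific
  components \<open>mult\<close> and \<open>one\<close> of the module record are unconstrained by that locale.\<close>

definition linear_map ::
  "('k, 'r) ring_scheme \<Rightarrow> ('k, 'u) module \<Rightarrow> ('k, 'v) module \<Rightarrow> ('u \<Rightarrow> 'v) \<Rightarrow> bool" where
  "linear_map K M N f \<longleftrightarrow>
     f \<in> carrier M \<rightarrow> carrier N \<and>
     (\<forall>x\<in>carrier M. \<forall>y\<in>carrier M. f (x \<oplus>\<^bsub>M\<^esub> y) = f x \<oplus>\<^bsub>N\<^esub> f y) \<and>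
     (\<forall>a\<in>carrier K. \<forall>x\<in>carrier M. f (a \<odot>\<^bsub>M\<^esub> x) = a \<odot>\<^bsub>N\<^esub> f x)"

definition fin_dim :: "('k, 'r) ring_scheme \<Rightarrow> ('k, 'v) module \<Rightarrow> bool" where
  "fin_dim K M \<longleftrightarrow>
     (\<exists>S. finite S \<and> S \<subseteq> carrier M \<and>
        (\<forall>v\<in>carrier M. \<exists>c\<in>S \<rightarrow> carrier K. v = (\<Oplus>\<^bsub>M\<^esub>s\<in>S. c s \<odot>\<^bsub>M\<^esub> s)))"

section \<open>Zigzag modules\<close>

datatype direction = Forward | Backward

text \<open>A zigzag type is a function \<open>\<tau> :: nat \<Rightarrow> direction\<close>, where \<open>\<tau> i\<close> is the direction of the arrow
  between the vertices \<open>i\<close> and \<open>i + 1\<close>. The tail and the head of that arrow are:\<close>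

definition tail :: "(nat \<Rightarrow> direction) \<Rightarrow> nat \<Rightarrow> nat" where
  "tail \<tau> i = (case \<tau> i of Forward \<Rightarrow> i | Backward \<Rightarrow> Suc i)"

definition head :: "(nat \<Rightarrow> direction) \<Rightarrow> nat \<Rightarrow> nat" where
  "head \<tau> i = (case \<tau> i of Forward \<Rightarrow> Suc i | Backward \<Rightarrow> i)"

text \<open>The vertices are \<open>lo, \<dots>, hi\<close>; spaces and arrows outside this range are junk that no
  definition below looks at. The map of the arrow between \<open>i\<close> and \<open>i + 1\<close> is \<open>arrow i\<close>.\<close>

record ('k, 'v) zigzag =
  lo :: nat
  hi :: nat
  space :: "nat \<Rightarrow> ('k, 'v) module"
  arrow :: "nat \<Rightarrow> 'v \<Rightarrow> 'v"

definition zigzag_module ::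
  "('k, 'r) ring_scheme \<Rightarrow> (nat \<Rightarrow> direction) \<Rightarrow> ('k, 'v) zigzag \<Rightarrow> bool" where
  "zigzag_module K \<tau> V \<longleftrightarrow>
     (\<forall>i\<in>{lo V..hi V}. module K (space V i) \<and> fin_dim K (space V i)) \<and>
     (\<forall>i\<in>{lo V..<hi V}. linear_map K (space V (tail \<tau> i)) (space V (head \<tau> i)) (arrow V i))"

definition restriction :: "('k, 'v) zigzag \<Rightarrow> nat \<Rightarrow> nat \<Rightarrow> ('k, 'v) zigzag" where
  "restriction V p q = V\<lparr>lo := p, hi := q\<rparr>"

text \<open>\<open>interval_module K p q b d\<close> is \<open>I[b,d]\<close> as a zigzag module with vertices \<open>p, \<dots>, q\<close>.\<close>

definition interval_module ::
  "('k, 'r) ring_scheme \<Rightarrow> nat \<Rightarrow> nat \<Rightarrow> nat \<Rightarrow> nat \<Rightarrow> ('k, 'k) zigzag" where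
  "interval_module K p q b d =
     \<lparr>lo = p, hi = q,
      space = (\<lambda>i. \<lparr>carrier = (if i \<in> {b..d} then carrier K else {\<zero>\<^bsub>K\<^esub>}),
                    mult = mult K, one = \<one>\<^bsub>K\<^esub>, zero = \<zero>\<^bsub>K\<^esub>, add = add K, smult = mult K\<rparr>),
      arrow = (\<lambda>i x. if i \<in> {b..d} \<and> Suc i \<in> {b..d} then x else \<zero>\<^bsub>K\<^esub>)\<rparr>"

section \<open>Morphisms\<close>

definition morphism ::
  "('k, 'r) ring_scheme \<Rightarrow> (nat \<Rightarrow> direction) \<Rightarrow> ('k, 'u) zigzag \<Rightarrow> ('k, 'v) zigzag \<Rightarrow>
   (nat \<Rightarrow> 'u \<Rightarrow> 'v) \<Rightarrow> bool" where
  "morphism K \<tau> U V \<phi> \<longleftrightarrow>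
     lo U = lo V \<and> hi U = hi V \<and>
     (\<forall>i\<in>{lo U..hi U}. linear_map K (space U i) (space V i) (\<phi> i)) \<and>
     (\<forall>i\<in>{lo U..<hi U}. \<forall>x\<in>carrier (space U (tail \<tau> i)).
        \<phi> (head \<tau> i) (arrow U i x) = arrow V i (\<phi> (tail \<tau> i) x))"

definition monomorphism ::
  "('k, 'r) ring_scheme \<Rightarrow> (nat \<Rightarrow> direction) \<Rightarrow> ('k, 'u) zigzag \<Rightarrow> ('k, 'v) zigzag \<Rightarrow>
   (nat \<Rightarrow> 'u \<Rightarrow> 'v) \<Rightarrow> bool" where
  "monomorphism K \<tau> U V \<phi> \<longleftrightarrow>
     morphism K \<tau> U V \<phi> \<and> (\<forall>i\<in>{lo U..hi U}. inj_on (\<phi> i) (carrier (space U i)))"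

definition left_inverse ::
  "('k, 'u) zigzag \<Rightarrow> (nat \<Rightarrow> 'u \<Rightarrow> 'v) \<Rightarrow> (nat \<Rightarrow> 'v \<Rightarrow> 'u) \<Rightarrow> bool" where
  "left_inverse U \<phi> \<rho> \<longleftrightarrow> (\<forall>i\<in>{lo U..hi U}. \<forall>x\<in>carrier (space U i). \<rho> i (\<phi> i x) = x)"

definition splits ::
  "('k, 'r) ring_scheme \<Rightarrow> (nat \<Rightarrow> direction) \<Rightarrow> ('k, 'u) zigzag \<Rightarrow> ('k, 'v) zigzag \<Rightarrow>
   (nat \<Rightarrow> 'u \<Rightarrow> 'v) \<Rightarrow> bool" where
  "splits K \<tau> U V \<phi> \<longleftrightarrow> (\<exists>\<rho>. morphism K \<tau> V U \<rho> \<and> left_inverse U \<phi> \<rho>)"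

definition isomorphic ::
  "('k, 'r) ring_scheme \<Rightarrow> (nat \<Rightarrow> direction) \<Rightarrow> ('k, 'u) zigzag \<Rightarrow> ('k, 'v) zigzag \<Rightarrow> bool" where
  "isomorphic K \<tau> U V \<longleftrightarrow>
     (\<exists>\<phi> \<psi>. morphism K \<tau> U V \<phi> \<and> morphism K \<tau> V U \<psi> \<and>
            left_inverse U \<phi> \<psi> \<and> left_inverse V \<psi> \<phi>)"

section \<open>Submodules and direct sums\<close>

definition zigzag_submodule ::
  "('k, 'r) ring_scheme \<Rightarrow> (nat \<Rightarrow> direction) \<Rightarrow> ('k, 'v) zigzag \<Rightarrow> (nat \<Rightarrow> 'v set) \<Rightarrow> bool" where
  "zigzag_submodule K \<tau> V W \<longleftrightarrow>
     (\<forall>i\<in>{lo V..hi V}. submodule (W i) K (space V i)) \<and>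
     (\<forall>i\<in>{lo V..<hi V}. arrow V i ` W (tail \<tau> i) \<subseteq> W (head \<tau> i))"

text \<open>A submodule, regarded as a zigzag module in its own right.\<close>

definition induced :: "('k, 'v) zigzag \<Rightarrow> (nat \<Rightarrow> 'v set) \<Rightarrow> ('k, 'v) zigzag" where
  "induced V W = V\<lparr>space := \<lambda>i. (space V i)\<lparr>carrier := W i\<rparr>\<rparr>"

definition direct_summand ::
  "('k, 'r) ring_scheme \<Rightarrow> (nat \<Rightarrow> direction) \<Rightarrow> ('k, 'v) zigzag \<Rightarrow> (nat \<Rightarrow> 'v set) \<Rightarrow> bool" where
  "direct_summand K \<tau> V W \<longleftrightarrow>
     zigzag_submodule K \<tau> V W \<and>
     (\<exists>W'. zigzag_submodule K \<tau> V W' \<and>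
        (\<forall>i\<in>{lo V..hi V}. W i \<inter> W' i = {\<zero>\<^bsub>space V i\<^esub>} \<and>
                          W i <+>\<^bsub>space V i\<^esub> W' i = carrier (space V i)))"

definition has_summand_isomorphic_to ::
  "('k, 'r) ring_scheme \<Rightarrow> (nat \<Rightarrow> direction) \<Rightarrow> ('k, 'v) zigzag \<Rightarrow> ('k, 'u) zigzag \<Rightarrow> bool" where
  "has_summand_isomorphic_to K \<tau> V U \<longleftrightarrow>
     (\<exists>W. direct_summand K \<tau> V W \<and> isomorphic K \<tau> (induced V W) U)"

text \<open>The submodule \<open>W\<close> of \<open>V\<close> is isomorphic to \<open>I[b,d]\<close>, with \<open>[b,d]\<close> a nonempty interval of
  vertices of \<open>V\<close>; \<open>b\<close> and \<open>d\<close> are then determined by \<open>W\<close>.\<close>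

definition is_interval ::
  "('k, 'r) ring_scheme \<Rightarrow> (nat \<Rightarrow> direction) \<Rightarrow> ('k, 'v) zigzag \<Rightarrow> (nat \<Rightarrow> 'v set) \<Rightarrow>
   nat \<Rightarrow> nat \<Rightarrow> bool" where
  "is_interval K \<tau> V W b d \<longleftrightarrow>
     lo V \<le> b \<and> b \<le> d \<and> d \<le> hi V \<and>
     isomorphic K \<tau> (induced V W) (interval_module K (lo V) (hi V) b d)"

definition interval_decomposition ::
  "('k, 'r) ring_scheme \<Rightarrow> (nat \<Rightarrow> direction) \<Rightarrow> ('k, 'v) zigzag \<Rightarrow>
   'a set \<Rightarrow> ('a \<Rightarrow> nat \<Rightarrow> 'v set) \<Rightarrow> bool" where
  "interval_decomposition K \<tau> V A J \<longleftrightarrow>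
     finite A \<and>
     (\<forall>\<alpha>\<in>A. zigzag_submodule K \<tau> V (J \<alpha>) \<and> (\<exists>b d. is_interval K \<tau> V (J \<alpha>) b d)) \<and>
     (\<forall>i\<in>{lo V..hi V}. \<forall>v\<in>carrier (space V i).
        \<exists>!x. x \<in> (\<Pi>\<^sub>E \<alpha>\<in>A. J \<alpha> i) \<and> v = (\<Oplus>\<^bsub>space V i\<^esub>\<alpha>\<in>A. x \<alpha>))"

section \<open>Breaker chains\<close>

definition breaker_pair ::
  "('k, 'r) ring_scheme \<Rightarrow> (nat \<Rightarrow> direction) \<Rightarrow> ('k, 'v) zigzag \<Rightarrow>
   (nat \<Rightarrow> 'v set) \<Rightarrow> (nat \<Rightarrow> 'v set) \<Rightarrow> bool" where
  "breaker_pair K \<tau> V J1 J2 \<longleftrightarrow>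
     (\<exists>b1 d1 b2 d2. is_interval K \<tau> V J1 b1 d1 \<and> is_interval K \<tau> V J2 b2 d2 \<and>
        b1 < b2 \<and> b2 \<le> d1 \<and> d1 < d2 \<and> \<tau> (b2 - 1) = Backward \<and> \<tau> d1 = Forward)"

text \<open>A chain is given by the list of the indices of its members.\<close>

definition breaker_chain ::
  "('k, 'r) ring_scheme \<Rightarrow> (nat \<Rightarrow> direction) \<Rightarrow> ('k, 'v) zigzag \<Rightarrow>
   'a set \<Rightarrow> ('a \<Rightarrow> nat \<Rightarrow> 'v set) \<Rightarrow> 'a list \<Rightarrow> bool" where
  "breaker_chain K \<tau> V A J as \<longleftrightarrow>
     2 \<le> length as \<and> set as \<subseteq> A \<and>
     (\<forall>j. Suc j < length as \<longrightarrow> breaker_pair K \<tau> V (J (as ! j)) (J (as ! Suc j)))"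

definition spans ::
  "('k, 'r) ring_scheme \<Rightarrow> (nat \<Rightarrow> direction) \<Rightarrow> ('k, 'v) zigzag \<Rightarrow>
   ('a \<Rightarrow> nat \<Rightarrow> 'v set) \<Rightarrow> 'a list \<Rightarrow> nat \<Rightarrow> nat \<Rightarrow> bool" where
  "spans K \<tau> V J as p q \<longleftrightarrow>
     (\<exists>d. is_interval K \<tau> V (J (hd as)) p d) \<and> (\<exists>b. is_interval K \<tau> V (J (last as)) b q)"

definition contains_spanning_breaker_chain ::
  "('k, 'r) ring_scheme \<Rightarrow> (nat \<Rightarrow> direction) \<Rightarrow> ('k, 'v) zigzag \<Rightarrow>
   'a set \<Rightarrow> ('a \<Rightarrow> nat \<Rightarrow> 'v set) \<Rightarrow> nat \<Rightarrow> nat \<Rightarrow> bool" where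
  "contains_spanning_breaker_chain K \<tau> V A J p q \<longleftrightarrow>
     (\<exists>as. breaker_chain K \<tau> V A J as \<and> spans K \<tau> V J as p q)"

end

theory Submission
  imports Defs
begin

text \<open>
  A map between interval modules is given by a single scalar. A nonzero map \<open>I[p,q] \<rightarrow> I[b,d]\<close> exists
  iff \<open>b = p\<close> or the arrow entering at \<open>b\<close> is backward, and \<open>d = q\<close> or the arrow leaving at \<open>d\<close> is
  forward; a nonzero composite \<open>I[p,q] \<rightarrow> I[b,d] \<rightarrow> I[p,q]\<close> forces \<open>[b,d] = [p,q]\<close>. Hence the summands
  on which a nonsplitting monomorphism is nonzero are intervals \<open>[b,d] \<noteq> [p,q]\<close> of the first kind
  that cover \<open>[p,q]\<close>. Walking greedily from \<open>p\<close>, always to the interval through \<open>d + 1\<close> that reaches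
  farthest, turns such a cover into a breaker chain. Conversely, the diagonal map into the members
  of a spanning breaker chain is injective, and its composite with any map to \<open>I[p,q]\<close> is zero.
\<close>

section \<open>Covers by intervals\<close>

text \<open>Injectivity is tested vertex by vertex, so different summands may do the work at
  different vertices, whereas a retraction must invert one scalar at all vertices at once. An
  interval that misses a vertex cannot contribute to such a scalar, so a family of proper intervals
  can carry an injective map that no retraction detects. That neighbours in such a family overlap,
  as breaker pairs must, is forced by the arrows: two adjacent disjoint intervals that both receive
  nonzero maps from \<open>U\<close> would make the arrow between them point both ways. Only
  endpoints matter for this combinatorics, so it is done with \<open>breaks\<close> on pairs of
  numbers. On the algebraic side each summand is represented by an inclusion \<open>e\<close> and a
  scalar coordinate \<open>c\<close>.\<close>

definition breaks :: "(nat \<Rightarrow> direction) \<Rightarrow> nat \<times> nat \<Rightarrow> nat \<times> nat \<Rightarrow> bool" where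
  "breaks \<tau> I I' \<longleftrightarrow>
     fst I < fst I' \<and> fst I' \<le> snd I \<and> snd I < snd I' \<and>
     \<tau> (fst I' - 1) = Backward \<and> \<tau> (snd I) = Forward"

text \<open>The maximality of \<alpha> among the intervals that start no later is the invariant of
  the greedy walk. Taking \<beta> farthest among the intervals through \<open>d \<alpha> + 1\<close>
  restores it: an interval that starts no later than \<beta> either contains
  \<open>d \<alpha> + 1\<close>, and then competes with \<beta>, or ends at
  \<open>d \<alpha>\<close> or before.\<close>

lemma chain_from_maximal:
  fixes b d :: "'a \<Rightarrow> nat"
  assumes fin: "finite S"
    and cov: "\<And>i. i \<in> {p..q} \<Longrightarrow> \<exists>\<alpha>\<in>S. i \<in> {b \<alpha>..d \<alpha>}"
    and rng: "\<And>\<alpha>. \<alpha> \<in> S \<Longrightarrow> p \<le> b \<alpha> \<and> b \<alpha> \<le> d \<alpha> \<and> d \<alpha> \<le> q"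
    and left: "\<And>\<alpha>. \<alpha> \<in> S \<Longrightarrow> b \<alpha> = p \<or> \<tau> (b \<alpha> - 1) = Backward"
    and right: "\<And>\<alpha>. \<alpha> \<in> S \<Longrightarrow> d \<alpha> = q \<or> \<tau> (d \<alpha>) = Forward"
    and \<alpha>: "\<alpha> \<in> S" "\<And>\<beta>. \<lbrakk>\<beta> \<in> S; b \<beta> \<le> b \<alpha>\<rbrakk> \<Longrightarrow> d \<beta> \<le> d \<alpha>"
  shows "\<exists>as. as \<noteq> [] \<and> set as \<subseteq> S \<and> hd as = \<alpha> \<and> d (last as) = q \<and>
           successively (\<lambda>\<alpha> \<beta>. breaks \<tau> (b \<alpha>, d \<alpha>) (b \<beta>, d \<beta>)) as"
  using \<alpha>
proof (induction "q - d \<alpha>" arbitrary: \<alpha> rule: less_induct)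
  case less
  show ?case
  proof (cases "d \<alpha> = q")
    case True
    then show ?thesis using less.prems by (intro exI[of _ "[\<alpha>]"]) auto
  next
    case False
    with rng[OF less.prems(1)] have dq: "d \<alpha> < q" "p \<le> d \<alpha>" by auto
    define T where "T = {\<beta> \<in> S. Suc (d \<alpha>) \<in> {b \<beta>..d \<beta>}}"
    have "finite T" "T \<noteq> {}" using fin cov[of "Suc (d \<alpha>)"] dq unfolding T_def by auto
    then obtain \<beta> where \<beta>T: "\<beta> \<in> T" and "Max (d ` T) = d \<beta>"
      by (rule obtains_MAX)
    with \<open>finite T\<close> have max: "\<And>\<gamma>. \<gamma> \<in> T \<Longrightarrow> d \<gamma> \<le> d \<beta>"
      by (metis Max_ge finite_imageI imageI)
    from \<beta>T have \<beta>: "\<beta> \<in> S" "b \<beta> \<le> Suc (d \<alpha>)" "d \<alpha> < d \<beta>" unfolding T_def by auto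
    have \<beta>max: "d \<gamma> \<le> d \<beta>" if "\<gamma> \<in> S" "b \<gamma> \<le> b \<beta>" for \<gamma>
      using max[of \<gamma>] that \<beta> unfolding T_def by force
    have "\<tau> (d \<alpha>) = Forward" using right less.prems(1) False by blast
    \<comment> \<open>Otherwise \<beta> would start no later than \<alpha> and still reach
      farther.\<close>
    moreover have "b \<alpha> < b \<beta>" using less.prems(2)[of \<beta>] \<beta> by force
    moreover have "\<tau> (b \<beta> - 1) = Backward"
      using left[OF \<beta>(1)] rng[OF less.prems(1)] \<open>b \<alpha> < b \<beta>\<close> by auto
    \<comment> \<open>If \<open>b \<beta>\<close> were \<open>d \<alpha> + 1\<close>, the same arrow
      would be both backward and forward; hence the two intervals overlap.\<close>
    ultimately have "breaks \<tau> (b \<alpha>, d \<alpha>) (b \<beta>, d \<beta>)"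
      using \<beta> unfolding breaks_def by (cases "b \<beta> = Suc (d \<alpha>)") auto
    moreover obtain as where "as \<noteq> []" "set as \<subseteq> S" "hd as = \<beta>" "d (last as) = q"
        "successively (\<lambda>\<alpha> \<beta>. breaks \<tau> (b \<alpha>, d \<alpha>) (b \<beta>, d \<beta>)) as"
      using less.hyps[OF diff_less_mono2[OF \<beta>(3) dq(1)] \<beta>(1) \<beta>max] by blast
    ultimately show ?thesis
      using less.prems(1) by (intro exI[of _ "\<alpha> # as"]) (auto simp: successively_Cons)
  qed
qed

text \<open>Nothing starts before \<open>p\<close>, so the longest interval starting at
  \<open>p\<close> satisfies the invariant of the greedy walk. The chain has a second member because
  one alone would have to be \<open>[p,q]\<close>, which \<open>proper\<close> excludes.\<close>

lemma cover_contains_breaking_chain: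
  fixes b d :: "'a \<Rightarrow> nat"
  assumes "p \<le> q" and fin: "finite S"
    and cov: "\<And>i. i \<in> {p..q} \<Longrightarrow> \<exists>\<alpha>\<in>S. i \<in> {b \<alpha>..d \<alpha>}"
    and rng: "\<And>\<alpha>. \<alpha> \<in> S \<Longrightarrow> p \<le> b \<alpha> \<and> b \<alpha> \<le> d \<alpha> \<and> d \<alpha> \<le> q"
    and left: "\<And>\<alpha>. \<alpha> \<in> S \<Longrightarrow> b \<alpha> = p \<or> \<tau> (b \<alpha> - 1) = Backward"
    and right: "\<And>\<alpha>. \<alpha> \<in> S \<Longrightarrow> d \<alpha> = q \<or> \<tau> (d \<alpha>) = Forward"
    and proper: "\<And>\<alpha>. \<alpha> \<in> S \<Longrightarrow> b \<alpha> \<noteq> p \<or> d \<alpha> \<noteq> q"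
  shows "\<exists>as. 2 \<le> length as \<and> set as \<subseteq> S \<and> b (hd as) = p \<and> d (last as) = q \<and>
           successively (\<lambda>\<alpha> \<beta>. breaks \<tau> (b \<alpha>, d \<alpha>) (b \<beta>, d \<beta>)) as"
proof -
  define T where "T = {\<beta> \<in> S. b \<beta> = p}"
  have "finite T" using fin unfolding T_def by simp
  moreover have "T \<noteq> {}" using cov[of p] rng \<open>p \<le> q\<close> unfolding T_def by force
  ultimately obtain \<alpha> where "\<alpha> \<in> T" and "Max (d ` T) = d \<alpha>"
    by (rule obtains_MAX)
  with \<open>finite T\<close> have "\<And>\<gamma>. \<gamma> \<in> T \<Longrightarrow> d \<gamma> \<le> d \<alpha>"
    by (metis Max_ge finite_imageI imageI)
  with \<open>\<alpha> \<in> T\<close> have \<alpha>: "\<alpha> \<in> S" "b \<alpha> = p" and max: "\<And>\<beta>. \<lbrakk>\<beta> \<in> S; b \<beta> \<le> b \<alpha>\<rbrakk> \<Longrightarrow> d \<beta> \<le> d \<alpha>"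
    using rng unfolding T_def by (auto simp: le_antisym)
  obtain as where as: "as \<noteq> []" "set as \<subseteq> S" "hd as = \<alpha>" "d (last as) = q"
      "successively (\<lambda>\<alpha> \<beta>. breaks \<tau> (b \<alpha>, d \<alpha>) (b \<beta>, d \<beta>)) as"
    using chain_from_maximal[OF fin cov rng left right \<alpha>(1) max] by blast
  moreover have "last as \<noteq> hd as" using as(3,4) \<alpha> proper by metis
  \<comment> \<open>The case rule of \<open>remdups_adj\<close> is borrowed for its split into
    empty, one-element and longer lists.\<close>
  then have "2 \<le> length as" using as(1) by (cases as rule: remdups_adj.cases) auto
  ultimately show ?thesis using \<alpha> by blast
qed

text \<open>Consecutive members overlap, so a vertex beyond the end of one member lies after the
  start of the next.\<close>

lemma breaking_chain_covers:
  assumes "as \<noteq> []" "successively (\<lambda>\<alpha> \<beta>. breaks \<tau> (b \<alpha>, d \<alpha>) (b \<beta>, d \<beta>)) as"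
    "b (hd as) \<le> i" "i \<le> d (last as)"
  shows "\<exists>\<alpha>\<in>set as. i \<in> {b \<alpha>..d \<alpha>}"
  using assms
proof (induction as)
  case (Cons \<alpha> as)
  show ?case
  proof (cases "i \<le> d \<alpha>")
    case True
    then show ?thesis using Cons.prems by auto
  next
    case False
    then have "as \<noteq> []" using Cons.prems by auto
    with False Cons.prems have "b (hd as) \<le> i" "i \<le> d (last as)"
      by (auto simp: successively_Cons breaks_def)
    then show ?thesis using Cons \<open>as \<noteq> []\<close> by (auto simp: successively_Cons)
  qed
qed simp

text \<open>A predecessor fixes the arrow at the left end of a member, a successor the arrow at its
  right end. The three conclusions are the conditions on single members under which a map into
  proper summands can be built.\<close>

lemma breaking_chain_properties:
  assumes "2 \<le> length as" "successively (\<lambda>\<alpha> \<beta>. breaks \<tau> (b \<alpha>, d \<alpha>) (b \<beta>, d \<beta>)) as"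
    and "\<alpha> \<in> set as"
  shows "\<alpha> = hd as \<or> \<tau> (b \<alpha> - 1) = Backward"
    and "\<alpha> = last as \<or> \<tau> (d \<alpha>) = Forward"
    and "b (hd as) < b \<alpha> \<or> d \<alpha> < d (last as)"
proof -
  have suc: "breaks \<tau> (b (as ! i), d (as ! i)) (b (as ! Suc i), d (as ! Suc i))"
    if "Suc i < length as" for i
    using assms(2) that unfolding successively_conv_nth by blast
  have mono_b: "b (as ! 0) \<le> b (as ! i)" if "i < length as" for i
    using that
  proof (induction i)
    case (Suc i)
    then show ?case using suc[of i] by (auto simp: breaks_def)
  qed simp
  have mono_d: "d (as ! i) \<le> d (as ! (length as - 1))" if "i \<le> length as - 1" for i
    using that
  proof (induction i rule: inc_induct)
    case (step i)
    then show ?case using suc[of i] by (fastforce simp: breaks_def)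
  qed simp
  obtain i where i: "i < length as" "\<alpha> = as ! i" using assms(3) by (auto simp: in_set_conv_nth)
  have "as \<noteq> []" using assms(1) by auto
  show "\<alpha> = hd as \<or> \<tau> (b \<alpha> - 1) = Backward"
    using i suc \<open>as \<noteq> []\<close> by (cases i) (auto simp: hd_conv_nth breaks_def)
  show "\<alpha> = last as \<or> \<tau> (d \<alpha>) = Forward"
    using i suc[of i] \<open>as \<noteq> []\<close>
    by (cases "i = length as - 1") (auto simp: last_conv_nth breaks_def)
  show "b (hd as) < b \<alpha> \<or> d \<alpha> < d (last as)"
  proof (cases i)
    case 0
    \<comment> \<open>The first member starts at the left end of the chain, so it must be told apart
      by its right end; here the length of at least two is essential.\<close>
    have "d (as ! 0) < d (as ! 1)" using suc[of 0] assms(1) by (simp add: breaks_def)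
    also have "\<dots> \<le> d (last as)" using mono_d[of 1] assms(1) \<open>as \<noteq> []\<close> by (simp add: last_conv_nth)
    finally show ?thesis using i 0 by simp
  next
    case (Suc j)
    then have "b (as ! 0) \<le> b (as ! j)" "b (as ! j) < b \<alpha>"
      using i suc[of j] mono_b[of j] by (auto simp: breaks_def)
    then show ?thesis using \<open>as \<noteq> []\<close> by (simp add: hd_conv_nth)
  qed
qed

section \<open>Morphisms of zigzag modules\<close>

lemma linear_mapD:
  assumes "linear_map K M N f"
  shows "x \<in> carrier M \<Longrightarrow> f x \<in> carrier N"
    and "\<lbrakk>x \<in> carrier M; y \<in> carrier M\<rbrakk> \<Longrightarrow> f (x \<oplus>\<^bsub>M\<^esub> y) = f x \<oplus>\<^bsub>N\<^esub> f y"
    and "\<lbrakk>a \<in> carrier K; x \<in> carrier M\<rbrakk> \<Longrightarrow> f (a \<odot>\<^bsub>M\<^esub> x) = a \<odot>\<^bsub>N\<^esub> f x"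
  using assms unfolding linear_map_def by auto

lemma linear_map_zero:
  assumes "linear_map K M N f" "module K M" "module K N"
  shows "f \<zero>\<^bsub>M\<^esub> = \<zero>\<^bsub>N\<^esub>"
proof -
  interpret M: module K M by fact
  interpret N: module K N by fact
  have "f (\<zero>\<^bsub>K\<^esub> \<odot>\<^bsub>M\<^esub> \<zero>\<^bsub>M\<^esub>) = \<zero>\<^bsub>K\<^esub> \<odot>\<^bsub>N\<^esub> f \<zero>\<^bsub>M\<^esub>"
    using linear_mapD[OF assms(1)] by blast
  then show ?thesis using linear_mapD(1)[OF assms(1), of "\<zero>\<^bsub>M\<^esub>"] by simp
qed

lemma linear_map_comp:
  "\<lbrakk>linear_map K L M f; linear_map K M N g\<rbrakk> \<Longrightarrow> linear_map K L N (g \<circ> f)"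
  unfolding linear_map_def by (auto simp: Pi_iff)

lemma linear_map_diff:
  assumes f: "linear_map K M N f" and M: "module K M" and N: "module K N"
    and "x \<in> carrier M" "y \<in> carrier M"
  shows "f (x \<ominus>\<^bsub>M\<^esub> y) = f x \<ominus>\<^bsub>N\<^esub> f y"
proof -
  interpret M: module K M by fact
  interpret N: module K N by fact
  note fD = linear_mapD[OF f]
  have neg: "f (\<ominus>\<^bsub>M\<^esub> y) = \<ominus>\<^bsub>N\<^esub> f y"
    using fD(3)[of "\<ominus>\<^bsub>K\<^esub> \<one>\<^bsub>K\<^esub>" y] fD(1)[of y] assms(5)
      M.smult_l_minus[of "\<one>\<^bsub>K\<^esub>" y] N.smult_l_minus[of "\<one>\<^bsub>K\<^esub>" "f y"] by simp
  have "\<ominus>\<^bsub>M\<^esub> y \<in> carrier M" using assms(5) by simp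
  then show ?thesis using fD(2)[of x "\<ominus>\<^bsub>M\<^esub> y"] assms(4) neg by (simp add: a_minus_def)
qed

text \<open>Negation is scaling by \<open>\<ominus> \<one>\<close>, so closure under scalars yields
  the closure under negation that \<open>submoduleI\<close> asks for.\<close>

lemma (in module) submodule_if_smult_closed:
  assumes "H \<subseteq> carrier M" "\<zero>\<^bsub>M\<^esub> \<in> H"
    and "\<And>a b. \<lbrakk>a \<in> H; b \<in> H\<rbrakk> \<Longrightarrow> a \<oplus>\<^bsub>M\<^esub> b \<in> H"
    and smult: "\<And>a x. \<lbrakk>a \<in> carrier R; x \<in> H\<rbrakk> \<Longrightarrow> a \<odot>\<^bsub>M\<^esub> x \<in> H"
  shows "submodule H R M"
proof (rule submoduleI[OF assms(1,2) _ assms(3,4)])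
  show "\<ominus>\<^bsub>M\<^esub> x \<in> H" if "x \<in> H" for x
    using smult[of "\<ominus> \<one>" x] smult_l_minus[of \<one> x] assms(1) that by auto
qed

lemma linear_map_image:
  assumes f: "linear_map K M N f" and M: "module K M" and N: "module K N"
  shows "submodule (f ` carrier M) K N"
proof -
  interpret M: module K M by fact
  interpret N: module K N by fact
  note fD = linear_mapD[OF f]
  show ?thesis
  proof (rule N.submodule_if_smult_closed)
    show "\<zero>\<^bsub>N\<^esub> \<in> f ` carrier M" using linear_map_zero[OF f M N] by (metis M.zero_closed imageI)
  qed (auto simp: fD(1) simp flip: fD(2,3))
qed

lemma linear_map_kernel:
  assumes f: "linear_map K M N f" and M: "module K M" and N: "module K N"
  shows "submodule {x \<in> carrier M. f x = \<zero>\<^bsub>N\<^esub>} K M"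
proof -
  interpret M: module K M by fact
  interpret N: module K N by fact
  show ?thesis
    by (rule M.submodule_if_smult_closed) (auto simp: linear_map_zero[OF f M N] linear_mapD[OF f])
qed

lemma linear_map_finsum:
  assumes f: "linear_map K M N f" and M: "module K M" and N: "module K N"
    and "finite A" "x \<in> A \<rightarrow> carrier M"
  shows "f (\<Oplus>\<^bsub>M\<^esub>\<alpha>\<in>A. x \<alpha>) = (\<Oplus>\<^bsub>N\<^esub>\<alpha>\<in>A. f (x \<alpha>))"
proof -
  interpret M: module K M by fact
  interpret N: module K N by fact
  show ?thesis
    using assms(4,5)
  proof (induction A)
    case empty
    then show ?case using linear_map_zero[OF f M N] by simp
  next
    case (insert \<alpha> A)
    then have "(\<lambda>\<alpha>. f (x \<alpha>)) \<in> insert \<alpha> A \<rightarrow> carrier N"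
      using linear_mapD(1)[OF f] by (auto simp: Pi_iff)
    moreover have "(\<Oplus>\<^bsub>M\<^esub>\<alpha>\<in>A. x \<alpha>) \<in> carrier M"
      using insert.prems by (intro M.finsum_closed) auto
    ultimately show ?case using insert by (auto simp: linear_mapD(2)[OF f] Pi_iff)
  qed
qed

section \<open>Composition and addition of morphisms\<close>

lemma tail_head_range:
  assumes "i \<in> {l..<h}"
  shows "tail \<tau> i \<in> {l..h}" "head \<tau> i \<in> {l..h}"
  using assms unfolding tail_def head_def by (auto split: direction.split)

lemma morphismD:
  assumes "morphism K \<tau> U V \<phi>"
  shows "lo U = lo V" "hi U = hi V"
    and "i \<in> {lo V..hi V} \<Longrightarrow> linear_map K (space U i) (space V i) (\<phi> i)"
    and "\<lbrakk>i \<in> {lo V..<hi V}; x \<in> carrier (space U (tail \<tau> i))\<rbrakk> \<Longrightarrow>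
         \<phi> (head \<tau> i) (arrow U i x) = arrow V i (\<phi> (tail \<tau> i) x)"
  using assms unfolding morphism_def by auto

lemma morphism_closed:
  "\<lbrakk>morphism K \<tau> U V \<phi>; i \<in> {lo V..hi V}; x \<in> carrier (space U i)\<rbrakk> \<Longrightarrow> \<phi> i x \<in> carrier (space V i)"
  using linear_mapD(1)[OF morphismD(3)] .

lemma morphism_comp:
  assumes "morphism K \<tau> U V \<phi>" "morphism K \<tau> V W \<psi>"
  shows "morphism K \<tau> U W (\<lambda>i x. \<psi> i (\<phi> i x))"
proof -
  note U = morphismD[OF assms(1)] and W = morphismD[OF assms(2)]
  have "linear_map K (space U i) (space W i) (\<lambda>x. \<psi> i (\<phi> i x))" if "i \<in> {lo U..hi U}" for i
    using linear_map_comp[OF U(3) W(3)] that U(1,2) W(1,2) by (simp add: comp_def)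
  moreover have "\<psi> (head \<tau> i) (\<phi> (head \<tau> i) (arrow U i x)) =
      arrow W i (\<psi> (tail \<tau> i) (\<phi> (tail \<tau> i) x))"
    if "i \<in> {lo U..<hi U}" "x \<in> carrier (space U (tail \<tau> i))" for i x
  proof -
    have "\<phi> (tail \<tau> i) x \<in> carrier (space V (tail \<tau> i))"
      using morphism_closed[OF assms(1) _ that(2)] tail_head_range(1)[OF that(1)] U(1,2) by auto
    then show ?thesis using that U W by simp
  qed
  ultimately show ?thesis unfolding morphism_def using U(1,2) W(1,2) by auto
qed

lemma zigzag_moduleD:
  assumes "zigzag_module K \<tau> V"
  shows "i \<in> {lo V..hi V} \<Longrightarrow> module K (space V i)"
    and "i \<in> {lo V..<hi V} \<Longrightarrow>
         linear_map K (space V (tail \<tau> i)) (space V (head \<tau> i)) (arrow V i)"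
  using assms unfolding zigzag_module_def by auto

text \<open>Together with the zero morphism this lets a map into several summands be assembled one
  summand at a time.\<close>

lemma morphism_add:
  assumes V: "zigzag_module K \<tau> V" and "morphism K \<tau> U V \<phi>" "morphism K \<tau> U V \<psi>"
    and U: "\<And>i. i \<in> {lo U..hi U} \<Longrightarrow> module K (space U i)"
  shows "morphism K \<tau> U V (\<lambda>i x. \<phi> i x \<oplus>\<^bsub>space V i\<^esub> \<psi> i x)"
proof -
  note \<phi> = morphismD[OF assms(2)] and \<psi> = morphismD[OF assms(3)]
  have "linear_map K (space U i) (space V i) (\<lambda>x. \<phi> i x \<oplus>\<^bsub>space V i\<^esub> \<psi> i x)"
    if i: "i \<in> {lo V..hi V}" for i
  proof -
    interpret V: module K "space V i" using zigzag_moduleD(1)[OF V i] .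
    note cl = linear_mapD[OF \<phi>(3)[OF i]] linear_mapD[OF \<psi>(3)[OF i]]
    show ?thesis unfolding linear_map_def
      by (auto simp: cl V.smult_r_distr V.a_ac)
  qed
  moreover have "\<phi> (head \<tau> i) (arrow U i x) \<oplus>\<^bsub>space V (head \<tau> i)\<^esub> \<psi> (head \<tau> i) (arrow U i x) =
      arrow V i (\<phi> (tail \<tau> i) x \<oplus>\<^bsub>space V (tail \<tau> i)\<^esub> \<psi> (tail \<tau> i) x)"
    if i: "i \<in> {lo V..<hi V}" "x \<in> carrier (space U (tail \<tau> i))" for i x
    using \<phi>(4)[OF i] \<psi>(4)[OF i] linear_mapD(2)[OF zigzag_moduleD(2)[OF V i(1)]]
      morphism_closed[OF assms(2) tail_head_range(1)[OF i(1)] i(2)]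
      morphism_closed[OF assms(3) tail_head_range(1)[OF i(1)] i(2)] by simp
  ultimately show ?thesis unfolding morphism_def using \<phi>(1,2) by auto
qed

lemma morphism_zero:
  assumes V: "zigzag_module K \<tau> V" and "lo U = lo V" "hi U = hi V"
  shows "morphism K \<tau> U V (\<lambda>i x. \<zero>\<^bsub>space V i\<^esub>)"
proof -
  have "linear_map K (space U i) (space V i) (\<lambda>x. \<zero>\<^bsub>space V i\<^esub>)" if i: "i \<in> {lo V..hi V}" for i
  proof -
    interpret V: module K "space V i" using zigzag_moduleD(1)[OF V i] .
    show ?thesis unfolding linear_map_def by auto
  qed
  moreover have "\<zero>\<^bsub>space V (head \<tau> i)\<^esub> = arrow V i \<zero>\<^bsub>space V (tail \<tau> i)\<^esub>"
    if i: "i \<in> {lo V..<hi V}" for i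
    using linear_map_zero[OF zigzag_moduleD(2)[OF V i]]
      zigzag_moduleD(1)[OF V] tail_head_range[OF i] by metis
  ultimately show ?thesis unfolding morphism_def using assms by auto
qed

section \<open>Submodules, projections and complements\<close>

lemma zigzag_submoduleD:
  assumes "zigzag_module K \<tau> V" "zigzag_submodule K \<tau> V W" and i: "i \<in> {lo V..hi V}"
  shows "x \<in> W i \<Longrightarrow> x \<in> carrier (space V i)"
    and "\<zero>\<^bsub>space V i\<^esub> \<in> W i"
    and "\<lbrakk>x \<in> W i; y \<in> W i\<rbrakk> \<Longrightarrow> x \<oplus>\<^bsub>space V i\<^esub> y \<in> W i"
    and "\<lbrakk>x \<in> W i; y \<in> W i\<rbrakk> \<Longrightarrow> x \<ominus>\<^bsub>space V i\<^esub> y \<in> W i"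
    and "\<lbrakk>a \<in> carrier K; x \<in> W i\<rbrakk> \<Longrightarrow> a \<odot>\<^bsub>space V i\<^esub> x \<in> W i"
proof -
  interpret V: module K "space V i" using zigzag_moduleD(1)[OF assms(1) i] .
  have W: "submodule (W i) K (space V i)"
    using assms(2) i unfolding zigzag_submodule_def by auto
  note cl = V.submoduleE[OF W]
  interpret W: subgroup "W i" "add_monoid (space V i)" using submodule.axioms(1)[OF W] .
  show "x \<in> W i \<Longrightarrow> x \<in> carrier (space V i)" "\<zero>\<^bsub>space V i\<^esub> \<in> W i"
    using cl(1) W.one_closed by auto
  show "\<lbrakk>x \<in> W i; y \<in> W i\<rbrakk> \<Longrightarrow> x \<oplus>\<^bsub>space V i\<^esub> y \<in> W i"
    "\<lbrakk>x \<in> W i; y \<in> W i\<rbrakk> \<Longrightarrow> x \<ominus>\<^bsub>space V i\<^esub> y \<in> W i"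
    "\<lbrakk>a \<in> carrier K; x \<in> W i\<rbrakk> \<Longrightarrow> a \<odot>\<^bsub>space V i\<^esub> x \<in> W i"
    using cl by (auto simp: a_minus_def)
qed

lemma zigzag_submodule_arrow:
  "\<lbrakk>zigzag_submodule K \<tau> V W; i \<in> {lo V..<hi V}; x \<in> W (tail \<tau> i)\<rbrakk> \<Longrightarrow>
   arrow V i x \<in> W (head \<tau> i)"
  unfolding zigzag_submodule_def by blast

lemma induced_simps [simp]:
  "lo (induced V W) = lo V" "hi (induced V W) = hi V" "arrow (induced V W) = arrow V"
  "space (induced V W) i = (space V i)\<lparr>carrier := W i\<rparr>"
  unfolding induced_def by simp_all

text \<open>Passing to \<open>induced\<close> changes only the carriers, so only the image of the
  map has to be controlled.\<close>

lemma morphism_to_induced_iff: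
  assumes "zigzag_module K \<tau> V" "zigzag_submodule K \<tau> V W"
  shows "morphism K \<tau> U (induced V W) \<phi> \<longleftrightarrow>
    morphism K \<tau> U V \<phi> \<and> (\<forall>i\<in>{lo V..hi V}. \<phi> i ` carrier (space U i) \<subseteq> W i)"
proof -
  have "linear_map K (space U i) ((space V i)\<lparr>carrier := W i\<rparr>) (\<phi> i) \<longleftrightarrow>
      linear_map K (space U i) (space V i) (\<phi> i) \<and> \<phi> i ` carrier (space U i) \<subseteq> W i"
    if "i \<in> {lo V..hi V}" for i
    using zigzag_submoduleD(1)[OF assms that] unfolding linear_map_def by auto
  then show ?thesis unfolding morphism_def by fastforce
qed

text \<open>Uniqueness makes the components linear and compatible with the arrows: the termwise sum,
  multiple or image of decompositions is again a decomposition, hence the one belonging to the sum,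
  multiple or image.\<close>

lemma decomposition_projections:
  assumes V: "zigzag_module K \<tau> V" and "finite A"
    and J: "\<And>\<alpha>. \<alpha> \<in> A \<Longrightarrow> zigzag_submodule K \<tau> V (J \<alpha>)"
    and ex1: "\<And>i v. \<lbrakk>i \<in> {lo V..hi V}; v \<in> carrier (space V i)\<rbrakk> \<Longrightarrow>
      \<exists>!x. x \<in> (\<Pi>\<^sub>E \<alpha>\<in>A. J \<alpha> i) \<and> v = (\<Oplus>\<^bsub>space V i\<^esub>\<alpha>\<in>A. x \<alpha>)"
  shows "\<exists>\<pi>. (\<forall>\<alpha>\<in>A. morphism K \<tau> V (induced V (J \<alpha>)) (\<pi> \<alpha>)) \<and>
    (\<forall>\<alpha>\<in>A. \<forall>\<beta>\<in>A. \<forall>i\<in>{lo V..hi V}. \<forall>v\<in>J \<beta> i.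
       \<pi> \<alpha> i v = (if \<alpha> = \<beta> then v else \<zero>\<^bsub>space V i\<^esub>)) \<and>
    (\<forall>i\<in>{lo V..hi V}. \<forall>v\<in>carrier (space V i). v = (\<Oplus>\<^bsub>space V i\<^esub>\<alpha>\<in>A. \<pi> \<alpha> i v))"
proof -
  define X where "X i v = (THE x. x \<in> (\<Pi>\<^sub>E \<alpha>\<in>A. J \<alpha> i) \<and> v = (\<Oplus>\<^bsub>space V i\<^esub>\<alpha>\<in>A. x \<alpha>))" for i v
  have X: "X i v \<in> (\<Pi>\<^sub>E \<alpha>\<in>A. J \<alpha> i)" "v = (\<Oplus>\<^bsub>space V i\<^esub>\<alpha>\<in>A. X i v \<alpha>)"
    if "i \<in> {lo V..hi V}" "v \<in> carrier (space V i)" for i v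
    using theI'[OF ex1[OF that]] unfolding X_def by auto
  have XJ: "X i v \<alpha> \<in> J \<alpha> i"
    if "i \<in> {lo V..hi V}" "v \<in> carrier (space V i)" "\<alpha> \<in> A" for i v \<alpha>
    using X(1)[OF that(1,2)] that(3) by auto
  note JV = zigzag_submoduleD[OF V J]
  \<comment> \<open>Uniqueness in usable form. Restricting \<open>x\<close> to \<open>A\<close>
    supplies the extensionality demanded by the product of the \<open>J \<alpha> i\<close>, so the
    families compared below may take any values outside \<open>A\<close>.\<close>
  have X_eq: "X i v \<alpha> = x \<alpha>"
    if i: "i \<in> {lo V..hi V}" and x: "\<And>\<alpha>. \<alpha> \<in> A \<Longrightarrow> x \<alpha> \<in> J \<alpha> i"
      and v: "v = (\<Oplus>\<^bsub>space V i\<^esub>\<alpha>\<in>A. x \<alpha>)" and "\<alpha> \<in> A" for i v x \<alpha>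
  proof -
    interpret V: module K "space V i" using zigzag_moduleD(1)[OF V i] .
    have xV: "x \<in> A \<rightarrow> carrier (space V i)" using x JV(1) i by auto
    then have "v \<in> carrier (space V i)" unfolding v by (rule V.finsum_closed)
    moreover have "restrict x A \<in> (\<Pi>\<^sub>E \<alpha>\<in>A. J \<alpha> i)" using x by auto
    moreover have "v = (\<Oplus>\<^bsub>space V i\<^esub>\<alpha>\<in>A. restrict x A \<alpha>)"
      unfolding v using xV by (intro V.finsum_cong') auto
    ultimately have "X i v = restrict x A" using ex1[OF i] X i by blast
    then show ?thesis using \<open>\<alpha> \<in> A\<close> by simp
  qed
  have X_add: "X i (v \<oplus>\<^bsub>space V i\<^esub> w) \<alpha> = X i v \<alpha> \<oplus>\<^bsub>space V i\<^esub> X i w \<alpha>"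
    and X_smult: "a \<in> carrier K \<Longrightarrow> X i (a \<odot>\<^bsub>space V i\<^esub> v) \<alpha> = a \<odot>\<^bsub>space V i\<^esub> X i v \<alpha>"
    if i: "i \<in> {lo V..hi V}" and v: "v \<in> carrier (space V i)"
      and w: "w \<in> carrier (space V i)" and "\<alpha> \<in> A" for i v w \<alpha> a
  proof -
    interpret V: module K "space V i" using zigzag_moduleD(1)[OF V i] .
    have cl: "X i v \<in> A \<rightarrow> carrier (space V i)" "X i w \<in> A \<rightarrow> carrier (space V i)"
      using XJ[OF i] JV(1) i v w by auto
    have "v \<oplus>\<^bsub>space V i\<^esub> w =
        (\<Oplus>\<^bsub>space V i\<^esub>\<alpha>\<in>A. X i v \<alpha>) \<oplus>\<^bsub>space V i\<^esub> (\<Oplus>\<^bsub>space V i\<^esub>\<alpha>\<in>A. X i w \<alpha>)"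
      using X(2)[OF i v] X(2)[OF i w] by metis
    also have "\<dots> = (\<Oplus>\<^bsub>space V i\<^esub>\<alpha>\<in>A. X i v \<alpha> \<oplus>\<^bsub>space V i\<^esub> X i w \<alpha>)"
      using V.finsum_addf[OF cl] by simp
    finally show "X i (v \<oplus>\<^bsub>space V i\<^esub> w) \<alpha> = X i v \<alpha> \<oplus>\<^bsub>space V i\<^esub> X i w \<alpha>"
      using XJ i v w JV(3) \<open>\<alpha> \<in> A\<close> by (intro X_eq) auto
    assume a: "a \<in> carrier K"
    have "a \<odot>\<^bsub>space V i\<^esub> v = a \<odot>\<^bsub>space V i\<^esub> (\<Oplus>\<^bsub>space V i\<^esub>\<alpha>\<in>A. X i v \<alpha>)"
      using X(2)[OF i v] by metis
    also have "\<dots> = (\<Oplus>\<^bsub>space V i\<^esub>\<alpha>\<in>A. a \<odot>\<^bsub>space V i\<^esub> X i v \<alpha>)"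
      by (rule V.finsum_smult_ldistr[OF \<open>finite A\<close> a cl(1)])
    finally show "X i (a \<odot>\<^bsub>space V i\<^esub> v) \<alpha> = a \<odot>\<^bsub>space V i\<^esub> X i v \<alpha>"
      using XJ i v JV(5) a \<open>\<alpha> \<in> A\<close> by (intro X_eq) auto
  qed
  have X_arrow: "X (head \<tau> i) (arrow V i v) \<alpha> = arrow V i (X (tail \<tau> i) v \<alpha>)"
    if i: "i \<in> {lo V..<hi V}" and v: "v \<in> carrier (space V (tail \<tau> i))" and "\<alpha> \<in> A" for i v \<alpha>
  proof -
    note th = tail_head_range[OF i, of \<tau>]
    have "X (tail \<tau> i) v \<in> A \<rightarrow> carrier (space V (tail \<tau> i))"
      using XJ[OF th(1)] JV(1) th v by auto
    then have "arrow V i v = (\<Oplus>\<^bsub>space V (head \<tau> i)\<^esub>\<alpha>\<in>A. arrow V i (X (tail \<tau> i) v \<alpha>))"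
      using linear_map_finsum[OF zigzag_moduleD(2)[OF V i] zigzag_moduleD(1)[OF V th(1)]
          zigzag_moduleD(1)[OF V th(2)] \<open>finite A\<close>] X(2)[OF th(1) v] by metis
    then show ?thesis
      using th v XJ zigzag_submodule_arrow[OF J i] \<open>\<alpha> \<in> A\<close> by (intro X_eq) auto
  qed
  show ?thesis
  proof (intro exI[of _ "\<lambda>\<alpha> i v. X i v \<alpha>"] conjI ballI)
    show "morphism K \<tau> V (induced V (J \<alpha>)) (\<lambda>i v. X i v \<alpha>)" if "\<alpha> \<in> A" for \<alpha>
      using that XJ X_add X_smult X_arrow unfolding morphism_def linear_map_def by auto
  next
    fix \<alpha> \<beta> i v
    assume \<alpha>: "\<alpha> \<in> A" and \<beta>: "\<beta> \<in> A" and i: "i \<in> {lo V..hi V}" and v: "v \<in> J \<beta> i"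
    interpret V: module K "space V i" using zigzag_moduleD(1)[OF V i] .
    have "v \<in> carrier (space V i)" using JV(1) i v \<beta> by blast
    \<comment> \<open>A vector of \<open>J \<beta> i\<close> is its own component at \<beta>, with
      zero at all other indices.\<close>
    then have "(\<Oplus>\<^bsub>space V i\<^esub>\<alpha>\<in>A. if \<beta> = \<alpha> then v else \<zero>\<^bsub>space V i\<^esub>) = v"
      using V.finsum_singleton[OF \<beta> \<open>finite A\<close>, of "\<lambda>_. v"] by simp
    then show "X i v \<alpha> = (if \<alpha> = \<beta> then v else \<zero>\<^bsub>space V i\<^esub>)"
      using X_eq[OF i, of "\<lambda>\<alpha>. if \<beta> = \<alpha> then v else \<zero>\<^bsub>space V i\<^esub>" v \<alpha>] JV(2)[OF _ i] v \<alpha>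
      by (metis (no_types, lifting))
  qed (use X in auto)
qed

text \<open>If \<open>a\<close>, \<open>c\<close> come from one submodule and \<open>b\<close>,
  \<open>d\<close> from a complement, the common difference lies in both and so vanishes. This gives
  uniqueness of the parts of a vector.\<close>

lemma (in abelian_group) add_eq_imp_minus_eq:
  assumes "a \<oplus> b = c \<oplus> d" "a \<in> carrier G" "b \<in> carrier G" "c \<in> carrier G" "d \<in> carrier G"
  shows "c \<ominus> a = b \<ominus> d"
proof -
  define u where "u = c \<ominus> a"
  have u: "u \<in> carrier G" "c = a \<oplus> u"
    using assms(2-) unfolding u_def by (simp_all add: a_minus_def a_lcomm[of a c] r_neg)
  then have "b = u \<oplus> d" using assms by (simp add: a_assoc)
  then have "b \<ominus> d = u" using u assms(5) by (simp add: a_minus_def a_assoc r_neg)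
  then show ?thesis unfolding u_def by simp
qed

text \<open>A summand with its complement is a decomposition indexed by the two truth values, so
  \<open>decomposition_projections\<close> provides the projection.\<close>

lemma direct_summand_projection:
  assumes V: "zigzag_module K \<tau> V" and "direct_summand K \<tau> V W"
  shows "\<exists>\<pi>. morphism K \<tau> V (induced V W) \<pi> \<and> (\<forall>i\<in>{lo V..hi V}. \<forall>v\<in>W i. \<pi> i v = v)"
proof -
  obtain W' where W: "zigzag_submodule K \<tau> V W" and W': "zigzag_submodule K \<tau> V W'"
    and dir: "\<And>i. i \<in> {lo V..hi V} \<Longrightarrow> W i \<inter> W' i = {\<zero>\<^bsub>space V i\<^esub>}"
    and sum: "\<And>i. i \<in> {lo V..hi V} \<Longrightarrow> W i <+>\<^bsub>space V i\<^esub> W' i = carrier (space V i)"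
    using assms(2) unfolding direct_summand_def by blast
  define J where "J k = (if k then W else W')" for k
  have J: "zigzag_submodule K \<tau> V (J k)" for k using W W' unfolding J_def by simp
  note D = zigzag_submoduleD[OF V W] and D' = zigzag_submoduleD[OF V W']
  have "\<exists>!x. x \<in> (\<Pi>\<^sub>E k\<in>UNIV. J k i) \<and> v = (\<Oplus>\<^bsub>space V i\<^esub>k\<in>UNIV. x k)"
    if i: "i \<in> {lo V..hi V}" and v: "v \<in> carrier (space V i)" for i v
  proof -
    interpret V: module K "space V i" using zigzag_moduleD(1)[OF V i] .
    have fs: "(\<Oplus>\<^bsub>space V i\<^esub>k\<in>UNIV. x k) = x True \<oplus>\<^bsub>space V i\<^esub> x False"
      if "\<And>k. x k \<in> J k i" for x
      using D(1)[OF i, of "x True"] D'(1)[OF i, of "x False"] that[of True] that[of False]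
      by (simp add: UNIV_bool J_def V.a_comm)
    have "v \<in> W i <+>\<^bsub>space V i\<^esub> W' i" using sum[OF i] v by simp
    then obtain w w' where w: "w \<in> W i" "w' \<in> W' i" "v = w \<oplus>\<^bsub>space V i\<^esub> w'"
      unfolding set_add_def' by blast
    show ?thesis
    proof (rule ex1I[of _ "\<lambda>k. if k then w else w'"])
      show "(\<lambda>k. if k then w else w') \<in> (\<Pi>\<^sub>E k\<in>UNIV. J k i) \<and>
          v = (\<Oplus>\<^bsub>space V i\<^esub>k\<in>UNIV. if k then w else w')"
        using w by (subst fs) (auto simp: J_def)
    next
      fix x
      assume "x \<in> (\<Pi>\<^sub>E k\<in>UNIV. J k i) \<and> v = (\<Oplus>\<^bsub>space V i\<^esub>k\<in>UNIV. x k)"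
      then have "\<And>k. x k \<in> J k i" and "v = x True \<oplus>\<^bsub>space V i\<^esub> x False"
        using fs[of x] by (auto simp: PiE_iff)
      then have x: "x True \<in> W i" "x False \<in> W' i"
        and eq: "w \<oplus>\<^bsub>space V i\<^esub> w' = x True \<oplus>\<^bsub>space V i\<^esub> x False"
        using w(3) unfolding J_def by (metis (full_types))+
      note cl = D(1)[OF i w(1)] D'(1)[OF i w(2)] D(1)[OF i x(1)] D'(1)[OF i x(2)]
      have "x True \<ominus>\<^bsub>space V i\<^esub> w = w' \<ominus>\<^bsub>space V i\<^esub> x False"
        using cl by (intro V.add_eq_imp_minus_eq[OF eq])
      moreover have "x True \<ominus>\<^bsub>space V i\<^esub> w \<in> W i" using D(4)[OF i] x w by blast
      moreover have "w' \<ominus>\<^bsub>space V i\<^esub> x False \<in> W' i" using D'(4)[OF i] x w by blast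
      ultimately have "x True \<ominus>\<^bsub>space V i\<^esub> w = \<zero>\<^bsub>space V i\<^esub>"
        using dir[OF i] by auto
      then have "x True = w" using cl V.add.inv_equality V.minus_equality
        by (metis a_minus_def V.add.inv_closed V.minus_minus)
      moreover from this have "x False = w'" using eq cl by simp
      ultimately show "x = (\<lambda>k. if k then w else w')" by (auto simp: fun_eq_iff)
    qed
  qed
  note ex1 = this
  obtain \<pi> where
    "\<forall>k\<in>UNIV. morphism K \<tau> V (induced V (J k)) (\<pi> k)"
    "\<forall>k\<in>UNIV. \<forall>l\<in>UNIV. \<forall>i\<in>{lo V..hi V}. \<forall>v\<in>J l i.
       \<pi> k i v = (if k = l then v else \<zero>\<^bsub>space V i\<^esub>)"
    using decomposition_projections[OF V finite_UNIV J ex1] by blast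
  moreover have "J True = W" unfolding J_def by simp
  ultimately show ?thesis by (intro exI[of _ "\<pi> True"]) (metis UNIV_I)
qed

text \<open>Given a summand, the projection onto it followed by its isomorphism to \<open>U\<close>
  retracts the inclusion. Given a retraction \<rho> of \<phi>, the image of \<phi> is complemented
  by the kernel of \<rho>.\<close>

lemma split_monomorphism_iff_summand:
  fixes U :: "('k, 'u) zigzag" and V :: "('k, 'v) zigzag"
  assumes V: "zigzag_module K \<tau> V" and U: "zigzag_module K \<tau> U"
  shows "(\<exists>\<phi>. monomorphism K \<tau> U V \<phi> \<and> splits K \<tau> U V \<phi>) \<longleftrightarrow> has_summand_isomorphic_to K \<tau> V U"
proof
  assume "has_summand_isomorphic_to K \<tau> V U"
  then obtain W \<theta> \<psi> where W: "direct_summand K \<tau> V W"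
    and \<theta>: "morphism K \<tau> (induced V W) U \<theta>" and \<psi>: "morphism K \<tau> U (induced V W) \<psi>"
    and inv: "left_inverse U \<psi> \<theta>"
    unfolding has_summand_isomorphic_to_def isomorphic_def by blast
  obtain \<pi> where \<pi>: "morphism K \<tau> V (induced V W) \<pi>"
    "\<And>i v. \<lbrakk>i \<in> {lo V..hi V}; v \<in> W i\<rbrakk> \<Longrightarrow> \<pi> i v = v"
    using direct_summand_projection[OF V W] by blast
  have W_sub: "zigzag_submodule K \<tau> V W" using W unfolding direct_summand_def by simp
  have \<psi>V: "morphism K \<tau> U V \<psi>" and \<psi>W: "\<forall>i\<in>{lo V..hi V}. \<psi> i ` carrier (space U i) \<subseteq> W i"
    using \<psi> unfolding morphism_to_induced_iff[OF V W_sub] by simp_all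
  have "inj_on (\<psi> i) (carrier (space U i))" if "i \<in> {lo U..hi U}" for i
    using inv that unfolding left_inverse_def inj_on_def by metis
  then have "monomorphism K \<tau> U V \<psi>" using \<psi>V unfolding monomorphism_def by blast
  moreover have "left_inverse U \<psi> (\<lambda>i v. \<theta> i (\<pi> i v))"
    using inv \<psi>W \<pi>(2) morphismD(1,2)[OF \<psi>V] unfolding left_inverse_def
    by (simp add: image_subset_iff)
  ultimately show "\<exists>\<phi>. monomorphism K \<tau> U V \<phi> \<and> splits K \<tau> U V \<phi>"
    using morphism_comp[OF \<pi>(1) \<theta>] unfolding splits_def by blast
next
  assume "\<exists>\<phi>. monomorphism K \<tau> U V \<phi> \<and> splits K \<tau> U V \<phi>"
  then obtain \<phi> \<rho> where \<phi>: "morphism K \<tau> U V \<phi>" and \<rho>: "morphism K \<tau> V U \<rho>"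
    and inv: "\<And>i x. \<lbrakk>i \<in> {lo U..hi U}; x \<in> carrier (space U i)\<rbrakk> \<Longrightarrow> \<rho> i (\<phi> i x) = x"
    unfolding splits_def monomorphism_def left_inverse_def by blast
  note lh = morphismD(1,2)[OF \<phi>]
  define W where "W i = \<phi> i ` carrier (space U i)" for i
  define W' where "W' i = {v \<in> carrier (space V i). \<rho> i v = \<zero>\<^bsub>space U i\<^esub>}" for i
  have W_sub: "submodule (W i) K (space V i)"
    and W'_sub: "submodule (W' i) K (space V i)"
    and int: "W i \<inter> W' i = {\<zero>\<^bsub>space V i\<^esub>}"
    and sum: "W i <+>\<^bsub>space V i\<^esub> W' i = carrier (space V i)"
    if i: "i \<in> {lo V..hi V}" for i
  proof -
    interpret V: module K "space V i" using zigzag_moduleD(1)[OF V i] .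
    interpret U: module K "space U i" using zigzag_moduleD(1)[OF U] i lh by simp
    have lin: "linear_map K (space U i) (space V i) (\<phi> i)" "linear_map K (space V i) (space U i) (\<rho> i)"
      using morphismD(3)[OF \<phi> i] morphismD(3)[OF \<rho>] i lh by auto
    note \<phi>i = linear_mapD[OF lin(1)] and \<rho>i = linear_mapD[OF lin(2)]
    note \<phi>0 = linear_map_zero[OF lin(1) U.module_axioms V.module_axioms]
      and \<rho>0 = linear_map_zero[OF lin(2) V.module_axioms U.module_axioms]
    show "submodule (W i) K (space V i)" "submodule (W' i) K (space V i)"
      unfolding W_def W'_def
      using linear_map_image[OF lin(1) U.module_axioms V.module_axioms]
        linear_map_kernel[OF lin(2) V.module_axioms U.module_axioms] .
    show "W i \<inter> W' i = {\<zero>\<^bsub>space V i\<^esub>}"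
      using \<phi>0 \<rho>0 inv[of i] i lh U.zero_closed unfolding W_def W'_def by force
    show "W i <+>\<^bsub>space V i\<^esub> W' i = carrier (space V i)"
    proof (intro equalityI subsetI)
      fix v assume "v \<in> W i <+>\<^bsub>space V i\<^esub> W' i"
      then show "v \<in> carrier (space V i)" using \<phi>i(1) unfolding set_add_def' W_def W'_def by auto
    next
      fix v assume v: "v \<in> carrier (space V i)"
      \<comment> \<open>The part of \<open>v\<close> in the image of \<phi>. Since \<rho> agrees on
        \<open>v\<close> and \<open>w\<close>, their difference lies in the kernel.\<close>
      define w where "w = \<phi> i (\<rho> i v)"
      have w: "w \<in> W i" "w \<in> carrier (space V i)" using v \<phi>i \<rho>i unfolding W_def w_def by auto
      have \<rho>w: "\<rho> i w = \<rho> i v" using inv \<rho>i(1) v i lh unfolding w_def by simp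
      have "\<rho> i (v \<ominus>\<^bsub>space V i\<^esub> w) = \<rho> i v \<ominus>\<^bsub>space U i\<^esub> \<rho> i w"
        using linear_map_diff[OF lin(2) V.module_axioms U.module_axioms] v w by blast
      then have "v \<ominus>\<^bsub>space V i\<^esub> w \<in> W' i"
        using v w \<rho>w \<rho>i(1) unfolding W'_def by (simp add: U.r_neg a_minus_def)
      moreover have "v = w \<oplus>\<^bsub>space V i\<^esub> (v \<ominus>\<^bsub>space V i\<^esub> w)"
        using v w by (simp add: a_minus_def V.a_lcomm[of w v] V.r_neg)
      ultimately show "v \<in> W i <+>\<^bsub>space V i\<^esub> W' i" using w unfolding set_add_def' by blast
    qed
  qed
  have "arrow V i v \<in> W (head \<tau> i)" if i: "i \<in> {lo V..<hi V}" and v: "v \<in> W (tail \<tau> i)" for i v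
  proof -
    obtain x where x: "x \<in> carrier (space U (tail \<tau> i))" "v = \<phi> (tail \<tau> i) x"
      using v unfolding W_def by blast
    then have "arrow V i v = \<phi> (head \<tau> i) (arrow U i x)" using morphismD(4)[OF \<phi> i] by simp
    then show ?thesis
      using linear_mapD(1)[OF zigzag_moduleD(2)[OF U]] x i lh unfolding W_def by auto
  qed
  then have W: "zigzag_submodule K \<tau> V W" using W_sub unfolding zigzag_submodule_def by blast
  have "arrow V i v \<in> W' (head \<tau> i)" if i: "i \<in> {lo V..<hi V}" and v: "v \<in> W' (tail \<tau> i)" for i v
  proof -
    have iU: "i \<in> {lo U..<hi U}" using i lh by simp
    have "\<rho> (head \<tau> i) (arrow V i v) = arrow U i \<zero>\<^bsub>space U (tail \<tau> i)\<^esub>"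
      using morphismD(4)[OF \<rho> iU, of v] v unfolding W'_def by simp
    also have "\<dots> = \<zero>\<^bsub>space U (head \<tau> i)\<^esub>"
      using linear_map_zero[OF zigzag_moduleD(2)[OF U iU]] zigzag_moduleD(1)[OF U]
        tail_head_range[OF iU] by metis
    finally show ?thesis
      using linear_mapD(1)[OF zigzag_moduleD(2)[OF V i]] v unfolding W'_def by auto
  qed
  then have W': "zigzag_submodule K \<tau> V W'" using W'_sub unfolding zigzag_submodule_def by blast
  have "direct_summand K \<tau> V W"
    using W W' int sum unfolding direct_summand_def by blast
  moreover have "isomorphic K \<tau> (induced V W) U"
    unfolding isomorphic_def
  proof (intro exI conjI)
    show "morphism K \<tau> U (induced V W) \<phi>"
      using \<phi> by (simp add: morphism_to_induced_iff[OF V W] W_def)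
    have "linear_map K ((space V i)\<lparr>carrier := W i\<rparr>) (space U i) (\<rho> i)" if "i \<in> {lo U..hi U}" for i
      using morphismD(3)[OF \<rho> that] zigzag_submoduleD(1)[OF V W] that lh
      unfolding linear_map_def by auto
    moreover have "\<rho> (head \<tau> i) (arrow V i x) = arrow U i (\<rho> (tail \<tau> i) x)"
      if "i \<in> {lo U..<hi U}" "x \<in> W (tail \<tau> i)" for i x
      using morphismD(4)[OF \<rho> that(1)] zigzag_submoduleD(1)[OF V W] that lh
        tail_head_range(1)[OF that(1)] by simp
    ultimately show "morphism K \<tau> (induced V W) U \<rho>" using lh unfolding morphism_def by simp
    show "left_inverse U \<phi> \<rho>" using inv unfolding left_inverse_def by blast
    show "left_inverse (induced V W) \<rho> \<phi>"
      using inv lh unfolding left_inverse_def W_def by auto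
  qed
  ultimately show "has_summand_isomorphic_to K \<tau> V U"
    unfolding has_summand_isomorphic_to_def by blast
qed

section \<open>Interval modules\<close>

lemma interval_module_simps [simp]:
  "lo (interval_module K p q b d) = p" "hi (interval_module K p q b d) = q"
  "carrier (space (interval_module K p q b d) i) = (if i \<in> {b..d} then carrier K else {\<zero>\<^bsub>K\<^esub>})"
  "zero (space (interval_module K p q b d) i) = \<zero>\<^bsub>K\<^esub>"
  "add (space (interval_module K p q b d) i) = add K"
  "smult (space (interval_module K p q b d) i) = mult K"
  "arrow (interval_module K p q b d) i x =
     (if i \<in> {b..d} \<and> Suc i \<in> {b..d} then x else \<zero>\<^bsub>K\<^esub>)"
  unfolding interval_module_def by simp_all

lemma tail_head_cases:
  obtains "\<tau> i = Forward" "tail \<tau> i = i" "head \<tau> i = Suc i"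
  | "\<tau> i = Backward" "tail \<tau> i = Suc i" "head \<tau> i = i"
  unfolding tail_def head_def by (cases "\<tau> i") simp_all

context field
begin

lemma module_interval_space: "module R (space (interval_module R p q b d) i)"
proof (rule moduleI)
  show "abelian_group (space (interval_module R p q b d) i)"
  proof (rule abelian_groupI)
    show "\<exists>y\<in>carrier (space (interval_module R p q b d) i).
        y \<oplus>\<^bsub>space (interval_module R p q b d) i\<^esub> x = \<zero>\<^bsub>space (interval_module R p q b d) i\<^esub>"
      if "x \<in> carrier (space (interval_module R p q b d) i)" for x
      using that l_neg[of x] by (intro bexI[of _ "\<ominus> x"]) (auto split: if_splits)
  qed (auto simp: a_ac split: if_splits)
qed (auto simp: is_cring l_distr r_distr m_assoc split: if_splits)

lemma interval_zigzag_module: "zigzag_module R \<tau> (interval_module R p q b d)"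
proof -
  have "fin_dim R (space (interval_module R p q b d) i)" for i
  proof -
    let ?M = "space (interval_module R p q b d) i"
    interpret M: module R ?M by (rule module_interval_space)
    \<comment> \<open>One generator is enough: \<one> on the support, while off it the space is zero
      and \<zero> spans it.\<close>
    define s where "s = (if i \<in> {b..d} then \<one> else \<zero>)"
    have s: "s \<in> carrier ?M" unfolding s_def by simp
    show ?thesis
      unfolding fin_dim_def
    proof (intro exI[of _ "{s}"] conjI ballI)
      fix v assume "v \<in> carrier ?M"
      then have v: "v \<in> carrier R" by (auto split: if_splits)
      have "(\<Oplus>\<^bsub>?M\<^esub>t\<in>{s}. v \<odot>\<^bsub>?M\<^esub> t) = v \<odot>\<^bsub>?M\<^esub> s"
        using s v M.smult_closed[OF v s]
        by (subst M.finsum_insert) (auto simp: Pi_iff split: if_splits)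
      then have "v = (\<Oplus>\<^bsub>?M\<^esub>t\<in>{s}. v \<odot>\<^bsub>?M\<^esub> t)"
        using \<open>v \<in> carrier ?M\<close> v unfolding s_def by (auto split: if_splits)
      then show "\<exists>c\<in>{s} \<rightarrow> carrier R. v = (\<Oplus>\<^bsub>?M\<^esub>t\<in>{s}. c t \<odot>\<^bsub>?M\<^esub> t)"
        using v by (intro bexI[of _ "\<lambda>_. v"]) auto
    qed (use s in auto)
  qed
  moreover have "linear_map R (space (interval_module R p q b d) (tail \<tau> i))
      (space (interval_module R p q b d) (head \<tau> i)) (arrow (interval_module R p q b d) i)" for i
    by (rule tail_head_cases[of \<tau> i]) (auto simp: linear_map_def)
  ultimately show ?thesis
    unfolding zigzag_module_def using module_interval_space by blast
qed

text \<open>Inside \<open>[b,d]\<close> both modules have identity arrows, so the square of each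
  arrow, whichever way it points, equates the values at its two ends.\<close>

lemma interval_hom_const:
  assumes h: "morphism R \<tau> (interval_module R p q p q) (interval_module R p q b d) h"
    and "p \<le> b" "d \<le> q" and i: "i \<in> {b..d}" and j: "j \<in> {b..d}" and x: "x \<in> carrier R"
  shows "h i x = h j x"
proof -
  have "h b x = h j x" if "b \<le> j" "j \<le> d" for j
    using that
  proof (induction rule: dec_induct)
    case (step k)
    then have "h (head \<tau> k) x = h (tail \<tau> k) x"
      using morphismD(4)[OF h, of k x] assms(2,3) x
      by (cases rule: tail_head_cases[of \<tau> k]) auto
    then show ?case using step by (cases rule: tail_head_cases[of \<tau> k]) auto
  qed simp
  then show ?thesis using i j by (metis atLeastAtMost_iff)
qed

text \<open>A forward arrow into \<open>b\<close> would come from a zero space of the target, so its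
  square forces the value at \<open>b\<close> to be zero; by constancy the map then vanishes on all
  of \<open>[b,d]\<close>. The right end is symmetric.\<close>

lemma interval_hom_ends:
  assumes h: "morphism R \<tau> (interval_module R p q p q) (interval_module R p q b d) h"
    and pq: "p \<le> b" "b \<le> d" "d \<le> q" and i: "i \<in> {b..d}" and x: "x \<in> carrier R"
    and nz: "h i x \<noteq> \<zero>"
  shows "b = p \<or> \<tau> (b - 1) = Backward" and "d = q \<or> \<tau> d = Forward"
proof -
  have nz': "h j x \<noteq> \<zero>" if "j \<in> {b..d}" for j
    using interval_hom_const[OF h pq(1,3) i that x] nz by simp
  show "b = p \<or> \<tau> (b - 1) = Backward"
  proof (rule ccontr)
    assume "\<not> (b = p \<or> \<tau> (b - 1) = Backward)"
    then have "b \<noteq> p" "\<tau> (b - 1) = Forward" by (auto intro: direction.exhaust)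
    \<comment> \<open>Since \<open>p \<le> b\<close> and \<open>b \<noteq> p\<close>, the truncated
      difference \<open>b - 1\<close> is a true predecessor and still a vertex.\<close>
    moreover from this obtain k where "b = Suc k" "p \<le> k" using pq(1) by (cases b) auto
    ultimately show False
      using morphismD(4)[OF h, of k x] pq x nz'[of b] by (auto simp: tail_def head_def)
  qed
  show "d = q \<or> \<tau> d = Forward"
  proof (rule ccontr)
    assume "\<not> (d = q \<or> \<tau> d = Forward)"
    then have "d \<noteq> q" "\<tau> d = Backward" by (auto intro: direction.exhaust)
    then show False
      using morphismD(4)[OF h, of d x] pq x nz'[of d] by (auto simp: tail_def head_def)
  qed
qed

text \<open>A square can fail only at an arrow whose head lies in \<open>[b,d]\<close> and whose
  tail does not: a forward arrow into \<open>b\<close> or a backward arrow into \<open>d\<close>.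
  The end conditions leave no such arrow between \<open>p\<close> and \<open>q\<close>.\<close>

lemma interval_hom:
  assumes "b = p \<or> \<tau> (b - 1) = Backward" and "d = q \<or> \<tau> d = Forward"
  shows "morphism R \<tau> (interval_module R p q p q) (interval_module R p q b d)
           (\<lambda>i x. if i \<in> {b..d} then x else \<zero>)"
proof -
  have "(if head \<tau> i \<in> {b..d} then x else \<zero>) =
      (if i \<in> {b..d} \<and> Suc i \<in> {b..d} then if tail \<tau> i \<in> {b..d} then x else \<zero> else \<zero>)"
    if "i \<in> {p..<q}" for i x
  proof (cases rule: tail_head_cases[of \<tau> i])
    case 1
    then have "Suc i = b \<Longrightarrow> b = p" using assms(1) by auto
    with 1 that show ?thesis by auto
  next
    case 2
    then have "i = d \<Longrightarrow> d = q" using assms(2) by auto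
    with 2 that show ?thesis by auto
  qed
  then show ?thesis
    unfolding morphism_def linear_map_def using tail_head_range[of _ p q \<tau>] by (auto 0 3)
qed

lemma interval_hom_scale:
  assumes "a \<in> carrier R"
  shows "morphism R \<tau> (interval_module R p q b d) (interval_module R p q b d) (\<lambda>i x. a \<otimes> x)"
  using assms by (auto simp: morphism_def linear_map_def r_distr m_lcomm)

text \<open>Some vertex of \<open>[p,q]\<close> is missing from \<open>[b,d]\<close>, and there the
  composite passes through a zero space. As an endomorphism of \<open>I[p,q]\<close> the composite
  takes the same value at every vertex, hence zero throughout.\<close>

lemma interval_factor_zero:
  assumes h: "morphism R \<tau> (interval_module R p q p q) (interval_module R p q b d) h"
    and g: "morphism R \<tau> (interval_module R p q b d) (interval_module R p q p q) g"
    and bd: "p \<le> b" "d \<le> q" "b \<noteq> p \<or> d \<noteq> q"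
    and i: "i \<in> {p..q}" and x: "x \<in> carrier R"
  shows "g i (h i x) = \<zero>"
proof -
  obtain j where j: "j \<in> {p..q}" "j \<notin> {b..d}" using bd i 
    by (metis atLeastAtMost_iff le_antisym linorder_not_le order.trans order_refl)
  have "h j x = \<zero>" using morphism_closed[OF h, of j x] j x by (auto split: if_splits)
  moreover have "g j \<zero> = \<zero>"
    using linear_map_zero[OF morphismD(3)[OF g] module_interval_space module_interval_space, of j] j
    by simp
  moreover have "g i (h i x) = g j (h j x)"
    using interval_hom_const[OF morphism_comp[OF h g] _ _ i j(1) x] by simp
  ultimately show ?thesis by simp
qed

section \<open>Endpoints and coordinates of interval summands\<close>

lemma is_interval_support:
  assumes V: "zigzag_module R \<tau> V" and W: "zigzag_submodule R \<tau> V W"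
    and I: "is_interval R \<tau> V W b d" and i: "i \<in> {lo V..hi V}"
  shows "i \<in> {b..d} \<longleftrightarrow> W i \<noteq> {\<zero>\<^bsub>space V i\<^esub>}"
proof -
  let ?I = "interval_module R (lo V) (hi V) b d"
  obtain \<theta> \<psi> where \<theta>: "morphism R \<tau> (induced V W) ?I \<theta>" and \<psi>: "morphism R \<tau> ?I (induced V W) \<psi>"
    and inv: "left_inverse (induced V W) \<theta> \<psi>" "left_inverse ?I \<psi> \<theta>"
    using I unfolding is_interval_def isomorphic_def by blast
  \<comment> \<open>Linearity of \<psi>, seen as a map into \<open>V\<close>, gives its value at
    zero; the value of \<theta> at zero then follows by inversion, without first making
    \<open>induced V W\<close> a family of modules.\<close>
  have "\<psi> i \<zero> = \<zero>\<^bsub>space V i\<^esub>"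
    using linear_map_zero[OF morphismD(3)[OF _ i] module_interval_space zigzag_moduleD(1)[OF V i]]
      \<psi> morphism_to_induced_iff[OF V W] by fastforce
  then have \<theta>0: "\<theta> i \<zero>\<^bsub>space V i\<^esub> = \<zero>"
    using inv(2)[unfolded left_inverse_def, rule_format, of i \<zero>] i by simp
  show ?thesis
  proof
    assume "i \<in> {b..d}"
    then have "\<psi> i \<one> \<in> W i" "\<theta> i (\<psi> i \<one>) = \<one>"
      using morphism_closed[OF \<psi>, of i \<one>] inv(2) i unfolding left_inverse_def by simp_all
    then show "W i \<noteq> {\<zero>\<^bsub>space V i\<^esub>}" using \<theta>0 by auto
  next
    assume nz: "W i \<noteq> {\<zero>\<^bsub>space V i\<^esub>}"
    show "i \<in> {b..d}"
    proof (rule ccontr)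
      assume "i \<notin> {b..d}"
      have "w = \<zero>\<^bsub>space V i\<^esub>" if "w \<in> W i" for w
      proof -
        have "\<theta> i w = \<zero>"
          using morphism_closed[OF \<theta>, of i w] that i \<open>i \<notin> {b..d}\<close> by (auto split: if_splits)
        then show ?thesis
          using inv(1)[unfolded left_inverse_def, rule_format, of i w] that i \<open>\<psi> i \<zero> = \<zero>\<^bsub>space V i\<^esub>\<close>
          by simp
      qed
      then show False using nz zigzag_submoduleD(2)[OF V W i] by blast
    qed
  qed
qed

text \<open>The support is visible in \<open>W\<close> itself, as the set of vertices with nonzero
  space. Uniqueness matters because each breaker pair and each spanning condition quantifies over
  endpoints anew, and neighbouring pairs must agree on the member they share.\<close>

lemma is_interval_unique:
  assumes "zigzag_module R \<tau> V" "zigzag_submodule R \<tau> V W"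
    and I: "is_interval R \<tau> V W b d" "is_interval R \<tau> V W b' d'"
  shows "b' = b" "d' = d"
proof -
  note bd = I[unfolded is_interval_def]
  have "i \<in> {b..d} \<longleftrightarrow> i \<in> {b'..d'}" if "i \<in> {lo V..hi V}" for i
    using is_interval_support[OF assms(1,2) _ that] I by blast
  then have "{b..d} = {b'..d'}" using bd by (auto simp: set_eq_iff) (meson order.trans)+
  then show "b' = b" "d' = d" using bd by (auto simp: Icc_eq_Icc)
qed

text \<open>The internal decomposition becomes a system of maps between \<open>V\<close> and genuine
  interval modules. Their orthogonality and the joint injectivity of the \<open>c \<alpha>\<close>
  stand in for the direct sum from here on.\<close>

lemma interval_coordinates:
  assumes V: "zigzag_module R \<tau> V" and dec: "interval_decomposition R \<tau> V A J"
  shows "\<exists>b d e c. (\<forall>\<alpha>\<in>A. is_interval R \<tau> V (J \<alpha>) (b \<alpha>) (d \<alpha>) \<and>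
      morphism R \<tau> (interval_module R (lo V) (hi V) (b \<alpha>) (d \<alpha>)) V (e \<alpha>) \<and>
      morphism R \<tau> V (interval_module R (lo V) (hi V) (b \<alpha>) (d \<alpha>)) (c \<alpha>)) \<and>
    (\<forall>\<alpha>\<in>A. \<forall>\<beta>\<in>A. \<forall>i\<in>{lo V..hi V}. \<forall>x. x \<in> (if i \<in> {b \<beta>..d \<beta>} then carrier R else {\<zero>}) \<longrightarrow>
      c \<alpha> i (e \<beta> i x) = (if \<alpha> = \<beta> then x else \<zero>)) \<and>
    (\<forall>i\<in>{lo V..hi V}. \<forall>v\<in>carrier (space V i). (\<forall>\<alpha>\<in>A. c \<alpha> i v = \<zero>) \<longrightarrow> v = \<zero>\<^bsub>space V i\<^esub>)"
proof -
  let ?I = "\<lambda>b d. interval_module R (lo V) (hi V) b d"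
  have "finite A" and J: "\<And>\<alpha>. \<alpha> \<in> A \<Longrightarrow> zigzag_submodule R \<tau> V (J \<alpha>)"
    and int: "\<forall>\<alpha>\<in>A. \<exists>b d. is_interval R \<tau> V (J \<alpha>) b d"
    and ex1: "\<And>i v. \<lbrakk>i \<in> {lo V..hi V}; v \<in> carrier (space V i)\<rbrakk> \<Longrightarrow>
      \<exists>!x. x \<in> (\<Pi>\<^sub>E \<alpha>\<in>A. J \<alpha> i) \<and> v = (\<Oplus>\<^bsub>space V i\<^esub>\<alpha>\<in>A. x \<alpha>)"
    using dec unfolding interval_decomposition_def by simp_all
  obtain \<pi> where \<pi>: "\<And>\<alpha>. \<alpha> \<in> A \<Longrightarrow> morphism R \<tau> V (induced V (J \<alpha>)) (\<pi> \<alpha>)"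
    and \<pi>J: "\<And>\<alpha> \<beta> i v. \<lbrakk>\<alpha> \<in> A; \<beta> \<in> A; i \<in> {lo V..hi V}; v \<in> J \<beta> i\<rbrakk> \<Longrightarrow>
       \<pi> \<alpha> i v = (if \<alpha> = \<beta> then v else \<zero>\<^bsub>space V i\<^esub>)"
    and \<pi>sum: "\<And>i v. \<lbrakk>i \<in> {lo V..hi V}; v \<in> carrier (space V i)\<rbrakk> \<Longrightarrow>
       v = (\<Oplus>\<^bsub>space V i\<^esub>\<alpha>\<in>A. \<pi> \<alpha> i v)"
    using decomposition_projections[OF V \<open>finite A\<close> J ex1] by metis
  obtain b d where bd: "\<forall>\<alpha>\<in>A. is_interval R \<tau> V (J \<alpha>) (b \<alpha>) (d \<alpha>)"
    using int by metis
  \<comment> \<open>The two inverse isomorphisms are chosen as one pair, so that a single choice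
    function keeps them matched.\<close>
  then have "\<forall>\<alpha>\<in>A. \<exists>\<theta>\<psi>. morphism R \<tau> (induced V (J \<alpha>)) (?I (b \<alpha>) (d \<alpha>)) (fst \<theta>\<psi>) \<and>
      morphism R \<tau> (?I (b \<alpha>) (d \<alpha>)) (induced V (J \<alpha>)) (snd \<theta>\<psi>) \<and>
      left_inverse (induced V (J \<alpha>)) (fst \<theta>\<psi>) (snd \<theta>\<psi>) \<and>
      left_inverse (?I (b \<alpha>) (d \<alpha>)) (snd \<theta>\<psi>) (fst \<theta>\<psi>)"
    unfolding is_interval_def isomorphic_def by (metis fst_conv snd_conv)
  from bchoice[OF this] obtain f where f: "\<forall>\<alpha>\<in>A. morphism R \<tau> (induced V (J \<alpha>)) (?I (b \<alpha>) (d \<alpha>)) (fst (f \<alpha>)) \<and>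
      morphism R \<tau> (?I (b \<alpha>) (d \<alpha>)) (induced V (J \<alpha>)) (snd (f \<alpha>)) \<and>
      left_inverse (induced V (J \<alpha>)) (fst (f \<alpha>)) (snd (f \<alpha>)) \<and>
      left_inverse (?I (b \<alpha>) (d \<alpha>)) (snd (f \<alpha>)) (fst (f \<alpha>))"
    ..
  define \<theta> where "\<theta> \<alpha> = fst (f \<alpha>)" for \<alpha>
  define \<psi> where "\<psi> \<alpha> = snd (f \<alpha>)" for \<alpha>
  have \<theta>: "morphism R \<tau> (induced V (J \<alpha>)) (?I (b \<alpha>) (d \<alpha>)) (\<theta> \<alpha>)"
    and \<psi>: "morphism R \<tau> (?I (b \<alpha>) (d \<alpha>)) (induced V (J \<alpha>)) (\<psi> \<alpha>)"
    and inv: "left_inverse (induced V (J \<alpha>)) (\<theta> \<alpha>) (\<psi> \<alpha>)"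
      "left_inverse (?I (b \<alpha>) (d \<alpha>)) (\<psi> \<alpha>) (\<theta> \<alpha>)" if "\<alpha> \<in> A" for \<alpha>
    using f that unfolding \<theta>_def \<psi>_def by simp_all
  have \<psi>V: "morphism R \<tau> (?I (b \<alpha>) (d \<alpha>)) V (\<psi> \<alpha>)"
    and \<psi>J: "\<And>i x. \<lbrakk>i \<in> {lo V..hi V}; x \<in> (if i \<in> {b \<alpha>..d \<alpha>} then carrier R else {\<zero>})\<rbrakk> \<Longrightarrow>
      \<psi> \<alpha> i x \<in> J \<alpha> i" if "\<alpha> \<in> A" for \<alpha>
    using \<psi>[OF that] unfolding morphism_to_induced_iff[OF V J[OF that]]
    by (simp_all add: image_subset_iff)
  have \<psi>0: "\<psi> \<alpha> i \<zero> = \<zero>\<^bsub>space V i\<^esub>" if "\<alpha> \<in> A" "i \<in> {lo V..hi V}" for \<alpha> i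
    using linear_map_zero[OF morphismD(3)[OF \<psi>V[OF that(1)] that(2)] module_interval_space
        zigzag_moduleD(1)[OF V that(2)]] by simp
  have \<theta>\<psi>: "\<theta> \<alpha> i (\<psi> \<alpha> i x) = x"
    if "\<alpha> \<in> A" "i \<in> {lo V..hi V}" "x \<in> (if i \<in> {b \<alpha>..d \<alpha>} then carrier R else {\<zero>})" for \<alpha> i x
    using inv(2)[OF that(1)] that(2,3) unfolding left_inverse_def by simp
  have \<psi>\<theta>: "\<psi> \<alpha> i (\<theta> \<alpha> i w) = w" if "\<alpha> \<in> A" "i \<in> {lo V..hi V}" "w \<in> J \<alpha> i" for \<alpha> i w
    using inv(1)[OF that(1)] that(2,3) unfolding left_inverse_def by simp
  show ?thesis
  proof (intro exI conjI ballI allI impI)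
    fix \<alpha> assume \<alpha>: "\<alpha> \<in> A"
    show "is_interval R \<tau> V (J \<alpha>) (b \<alpha>) (d \<alpha>)" using bd \<alpha> by blast
    show "morphism R \<tau> (?I (b \<alpha>) (d \<alpha>)) V (\<psi> \<alpha>)" by (rule \<psi>V[OF \<alpha>])
    show "morphism R \<tau> V (?I (b \<alpha>) (d \<alpha>)) ((\<lambda>\<alpha> i v. \<theta> \<alpha> i (\<pi> \<alpha> i v)) \<alpha>)"
      using morphism_comp[OF \<pi>[OF \<alpha>] \<theta>[OF \<alpha>]] .
  next
    fix \<alpha> \<beta> i x
    assume \<alpha>: "\<alpha> \<in> A" and \<beta>: "\<beta> \<in> A" and i: "i \<in> {lo V..hi V}"
      and x: "x \<in> (if i \<in> {b \<beta>..d \<beta>} then carrier R else {\<zero>})"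
    have "\<theta> \<alpha> i \<zero>\<^bsub>space V i\<^esub> = \<zero>"
      using \<theta>\<psi>[OF \<alpha> i, of \<zero>] \<psi>0[OF \<alpha> i] by simp
    then show "\<theta> \<alpha> i (\<pi> \<alpha> i (\<psi> \<beta> i x)) = (if \<alpha> = \<beta> then x else \<zero>)"
      using \<pi>J[OF \<alpha> \<beta> i \<psi>J[OF \<beta> i x]] \<theta>\<psi>[OF \<beta> i x] by simp
  next
    fix i v
    assume i: "i \<in> {lo V..hi V}" and v: "v \<in> carrier (space V i)"
      and zero: "\<forall>\<alpha>\<in>A. \<theta> \<alpha> i (\<pi> \<alpha> i v) = \<zero>"
    interpret V: module R "space V i" using zigzag_moduleD(1)[OF V i] .
    \<comment> \<open>As \<open>\<psi> \<alpha>\<close> inverts \<open>\<theta> \<alpha>\<close>, a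
      vanishing coordinate means a vanishing projection, and \<open>v\<close> is the sum of its
      projections.\<close>
    have "\<pi> \<alpha> i v = \<zero>\<^bsub>space V i\<^esub>" if "\<alpha> \<in> A" for \<alpha>
      using \<psi>\<theta>[OF that i, of "\<pi> \<alpha> i v"] morphism_closed[OF \<pi>[OF that], of i v] i v zero that
        \<psi>0[OF that i] by simp
    then have "(\<Oplus>\<^bsub>space V i\<^esub>\<alpha>\<in>A. \<pi> \<alpha> i v) = (\<Oplus>\<^bsub>space V i\<^esub>\<alpha>\<in>A. \<zero>\<^bsub>space V i\<^esub>)"
      by (intro V.finsum_cong') auto
    then show "v = \<zero>\<^bsub>space V i\<^esub>" using \<pi>sum[OF i v] by simp
  qed
qed

end

section \<open>Breaker chains and nonsplitting monomorphisms\<close>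

context field
begin

text \<open>Uniqueness of endpoints removes the existential quantifiers from the definitions and
  leaves a statement about the numbers \<open>b \<alpha>\<close> and
  \<open>d \<alpha>\<close>.\<close>

lemma contains_spanning_breaker_chain_iff:
  assumes V: "zigzag_module R \<tau> V" and J: "\<And>\<alpha>. \<alpha> \<in> A \<Longrightarrow> zigzag_submodule R \<tau> V (J \<alpha>)"
    and bd: "\<And>\<alpha>. \<alpha> \<in> A \<Longrightarrow> is_interval R \<tau> V (J \<alpha>) (b \<alpha>) (d \<alpha>)"
  shows "contains_spanning_breaker_chain R \<tau> V A J p q \<longleftrightarrow>
    (\<exists>as. 2 \<le> length as \<and> set as \<subseteq> A \<and> b (hd as) = p \<and> d (last as) = q \<and>
       successively (\<lambda>\<alpha> \<beta>. breaks \<tau> (b \<alpha>, d \<alpha>) (b \<beta>, d \<beta>)) as)"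
proof -
  have uniq: "is_interval R \<tau> V (J \<alpha>) b' d' \<longleftrightarrow> b' = b \<alpha> \<and> d' = d \<alpha>" if "\<alpha> \<in> A" for \<alpha> b' d'
    using is_interval_unique[OF V J[OF that] bd[OF that]] bd[OF that] by blast
  have pair: "breaker_pair R \<tau> V (J \<alpha>) (J \<beta>) \<longleftrightarrow> breaks \<tau> (b \<alpha>, d \<alpha>) (b \<beta>, d \<beta>)"
    if "\<alpha> \<in> A" "\<beta> \<in> A" for \<alpha> \<beta>
    using that by (auto simp: breaker_pair_def breaks_def uniq)
  have "breaker_chain R \<tau> V A J as \<and> spans R \<tau> V J as p q \<longleftrightarrow>
      2 \<le> length as \<and> set as \<subseteq> A \<and> b (hd as) = p \<and> d (last as) = q \<and>
       successively (\<lambda>\<alpha> \<beta>. breaks \<tau> (b \<alpha>, d \<alpha>) (b \<beta>, d \<beta>)) as" for as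
  \<comment> \<open>Endpoints are known only for members of \<open>A\<close>, and \<open>hd\<close>
    and \<open>last\<close> need a nonempty list; in the other case both sides are false.\<close>
  proof (cases "2 \<le> length as \<and> set as \<subseteq> A")
    case True
    then have as: "as \<noteq> []" "\<And>i. i < length as \<Longrightarrow> as ! i \<in> A"
      by (auto dest: nth_mem)
    then have "hd as \<in> A" "last as \<in> A" using True hd_in_set last_in_set by blast+
    then have "spans R \<tau> V J as p q \<longleftrightarrow> b (hd as) = p \<and> d (last as) = q"
      unfolding spans_def by (auto simp: uniq)
    moreover have "(\<forall>j. Suc j < length as \<longrightarrow> breaker_pair R \<tau> V (J (as ! j)) (J (as ! Suc j))) \<longleftrightarrow>
        successively (\<lambda>\<alpha> \<beta>. breaks \<tau> (b \<alpha>, d \<alpha>) (b \<beta>, d \<beta>)) as"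
      unfolding successively_conv_nth by (simp add: pair as(2))
    ultimately show ?thesis using True unfolding breaker_chain_def by blast
  next
    case False
    then show ?thesis unfolding breaker_chain_def by blast
  qed
  then show ?thesis unfolding contains_spanning_breaker_chain_def by simp
qed

text \<open>The map is the sum over \<open>S\<close> of the canonical maps into the summands. Each
  term factors through a proper interval, so every map back to \<open>I[p,q]\<close> kills it. The
  induction runs over arbitrary finite sets because removing a member may destroy a chain, whereas
  the conditions on single members survive.\<close>

lemma morphism_into_proper_summands:
  fixes A :: "'c set" and V :: "('a, 'v) zigzag"
  defines "I \<equiv> interval_module R (lo V) (hi V)"
  assumes V: "zigzag_module R \<tau> V"
    and e: "\<And>\<alpha>. \<alpha> \<in> A \<Longrightarrow> morphism R \<tau> (I (b \<alpha>) (d \<alpha>)) V (e \<alpha>)"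
    and c: "\<And>\<alpha>. \<alpha> \<in> A \<Longrightarrow> morphism R \<tau> V (I (b \<alpha>) (d \<alpha>)) (c \<alpha>)"
    and ce: "\<And>\<alpha> \<beta> i x. \<lbrakk>\<alpha> \<in> A; \<beta> \<in> A; i \<in> {lo V..hi V};
      x \<in> (if i \<in> {b \<beta>..d \<beta>} then carrier R else {\<zero>})\<rbrakk> \<Longrightarrow> c \<alpha> i (e \<beta> i x) = (if \<alpha> = \<beta> then x else \<zero>)"
    and "finite S" "S \<subseteq> A"
    and rng: "\<And>\<alpha>. \<alpha> \<in> S \<Longrightarrow> lo V \<le> b \<alpha> \<and> b \<alpha> \<le> d \<alpha> \<and> d \<alpha> \<le> hi V"
    and left: "\<And>\<alpha>. \<alpha> \<in> S \<Longrightarrow> b \<alpha> = lo V \<or> \<tau> (b \<alpha> - 1) = Backward"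
    and right: "\<And>\<alpha>. \<alpha> \<in> S \<Longrightarrow> d \<alpha> = hi V \<or> \<tau> (d \<alpha>) = Forward"
    and proper: "\<And>\<alpha>. \<alpha> \<in> S \<Longrightarrow> b \<alpha> \<noteq> lo V \<or> d \<alpha> \<noteq> hi V"
  shows "\<exists>\<phi>. morphism R \<tau> (I (lo V) (hi V)) V \<phi> \<and>
    (\<forall>\<alpha>\<in>A. \<forall>i\<in>{lo V..hi V}. \<forall>x\<in>carrier R.
       c \<alpha> i (\<phi> i x) = (if \<alpha> \<in> S \<and> i \<in> {b \<alpha>..d \<alpha>} then x else \<zero>)) \<and>
    (\<forall>\<rho>. morphism R \<tau> V (I (lo V) (hi V)) \<rho> \<longrightarrow>
       (\<forall>i\<in>{lo V..hi V}. \<forall>x\<in>carrier R. \<rho> i (\<phi> i x) = \<zero>))"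
  using \<open>finite S\<close> \<open>S \<subseteq> A\<close> rng left right proper
proof (induction S)
  case empty
  let ?U = "I (lo V) (hi V)"
  have zero: "f i \<zero>\<^bsub>space V i\<^esub> = \<zero>" if "morphism R \<tau> V (I b' d') f" "i \<in> {lo V..hi V}" for f i b' d'
    using linear_map_zero[OF morphismD(3)[OF that(1)] zigzag_moduleD(1)[OF V that(2)]]
      module_interval_space that(2) unfolding I_def by simp
  show ?case
  proof (intro exI[of _ "\<lambda>i x. \<zero>\<^bsub>space V i\<^esub>"] conjI ballI allI impI)
    show "morphism R \<tau> ?U V (\<lambda>i x. \<zero>\<^bsub>space V i\<^esub>)"
      by (rule morphism_zero[OF V]) (simp_all add: I_def)
  qed (simp_all add: zero[OF c] zero)
next
  case (insert \<beta> S)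
  let ?U = "I (lo V) (hi V)"
  let ?\<iota> = "\<lambda>i x. if i \<in> {b \<beta>..d \<beta>} then x else \<zero>"
  have \<beta>: "\<beta> \<in> A" and "S \<subseteq> A" using insert.prems by auto
  obtain \<phi> where \<phi>: "morphism R \<tau> ?U V \<phi>"
    and c\<phi>: "\<forall>\<alpha>\<in>A. \<forall>i\<in>{lo V..hi V}. \<forall>x\<in>carrier R.
       c \<alpha> i (\<phi> i x) = (if \<alpha> \<in> S \<and> i \<in> {b \<alpha>..d \<alpha>} then x else \<zero>)"
    and \<rho>\<phi>: "\<forall>\<rho>. morphism R \<tau> V ?U \<rho> \<longrightarrow>
       (\<forall>i\<in>{lo V..hi V}. \<forall>x\<in>carrier R. \<rho> i (\<phi> i x) = \<zero>)"
    using insert.IH[OF \<open>S \<subseteq> A\<close>] insert.prems(2-) by auto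
  have \<iota>: "morphism R \<tau> ?U (I (b \<beta>) (d \<beta>)) ?\<iota>"
    unfolding I_def using insert.prems(3,4) by (intro interval_hom) auto
  \<comment> \<open>The term of the new summand \<beta>; it adds the coordinate at \<beta> and, by
    orthogonality, leaves the others alone.\<close>
  define \<psi> where "\<psi> i x = e \<beta> i (?\<iota> i x)" for i x
  have \<psi>: "morphism R \<tau> ?U V \<psi>" unfolding \<psi>_def by (rule morphism_comp[OF \<iota> e[OF \<beta>]])
  have cl: "\<phi> i x \<in> carrier (space V i)" "\<psi> i x \<in> carrier (space V i)"
    if "i \<in> {lo V..hi V}" "x \<in> carrier R" for i x
    using morphism_closed[OF \<phi>, of i x] morphism_closed[OF \<psi>, of i x] that by (simp_all add: I_def)
  have add: "f i (\<phi> i x \<oplus>\<^bsub>space V i\<^esub> \<psi> i x) = f i (\<phi> i x) \<oplus> f i (\<psi> i x)"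
    if "morphism R \<tau> V (I b' d') f" "i \<in> {lo V..hi V}" "x \<in> carrier R" for f i x b' d'
    using linear_mapD(2)[OF morphismD(3)[OF that(1)] cl[OF that(2,3)]] that(2)
    by (simp add: I_def)
  show ?case
  proof (intro exI[of _ "\<lambda>i x. \<phi> i x \<oplus>\<^bsub>space V i\<^esub> \<psi> i x"] conjI ballI allI impI)
    show "morphism R \<tau> ?U V (\<lambda>i x. \<phi> i x \<oplus>\<^bsub>space V i\<^esub> \<psi> i x)"
      by (rule morphism_add[OF V \<phi> \<psi>]) (simp add: I_def module_interval_space)
  next
    fix \<alpha> i x assume \<alpha>: "\<alpha> \<in> A" and i: "i \<in> {lo V..hi V}" and x: "x \<in> carrier R"
    have "c \<alpha> i (\<psi> i x) = (if \<alpha> = \<beta> then ?\<iota> i x else \<zero>)"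
      unfolding \<psi>_def using x by (intro ce[OF \<alpha> \<beta> i]) auto
    then show "c \<alpha> i (\<phi> i x \<oplus>\<^bsub>space V i\<^esub> \<psi> i x) =
        (if \<alpha> \<in> insert \<beta> S \<and> i \<in> {b \<alpha>..d \<alpha>} then x else \<zero>)"
      using add[OF c[OF \<alpha>] i x] c\<phi> \<alpha> i x \<open>\<beta> \<notin> S\<close> by auto
  next
    fix \<rho> i x assume \<rho>: "morphism R \<tau> V ?U \<rho>" and i: "i \<in> {lo V..hi V}" and x: "x \<in> carrier R"
    \<comment> \<open>Restricted to the summand \<beta>, the map \<rho> starts at a proper interval
      module, so \<open>interval_factor_zero\<close> applies.\<close>
    have "morphism R \<tau> (I (b \<beta>) (d \<beta>)) ?U (\<lambda>i x. \<rho> i (e \<beta> i x))"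
      by (rule morphism_comp[OF e[OF \<beta>] \<rho>])
    then have "\<rho> i (\<psi> i x) = \<zero>"
      unfolding \<psi>_def using insert.prems(2,5)[of \<beta>]
      by (intro interval_factor_zero[OF \<iota>[unfolded I_def], of "\<lambda>i x. \<rho> i (e \<beta> i x)" i x, folded I_def])
        (use i x in auto)
    then show "\<rho> i (\<phi> i x \<oplus>\<^bsub>space V i\<^esub> \<psi> i x) = \<zero>"
      using add[OF \<rho> i x] \<rho>\<phi>[rule_format, OF \<rho> i x] by simp
  qed
qed

text \<open>The composite of \<phi> and \<open>c\<close> is an endomorphism of
  \<open>I[p,q]\<close>, that is, multiplication by one scalar \<open>s\<close>. Being nonzero at
  one vertex, \<open>s\<close> is a unit, and \<open>c\<close> scaled by its inverse is a
  retraction.\<close>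

lemma splits_if_full_component:
  fixes V :: "('a, 'v) zigzag"
  defines "U \<equiv> interval_module R (lo V) (hi V) (lo V) (hi V)"
  assumes \<phi>: "morphism R \<tau> U V \<phi>" and c: "morphism R \<tau> V U c"
    and i: "i \<in> {lo V..hi V}" and nz: "c i (\<phi> i \<one>) \<noteq> \<zero>"
  shows "splits R \<tau> U V \<phi>"
proof -
  define s where "s = c i (\<phi> i \<one>)"
  have comp: "morphism R \<tau> U U (\<lambda>i x. c i (\<phi> i x))" by (rule morphism_comp[OF \<phi> c])
  have s: "s \<in> Units R"
    using morphism_closed[OF comp, of i \<one>] i nz unfolding s_def U_def by (simp add: field_Units)
  have "c j (\<phi> j x) = x \<otimes> s" if j: "j \<in> {lo V..hi V}" and x: "x \<in> carrier R" for j x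
  proof -
    have "c j (\<phi> j (x \<otimes> \<one>)) = x \<otimes> c j (\<phi> j \<one>)"
      using linear_mapD(3)[OF morphismD(3)[OF comp], of j x \<one>] j x unfolding U_def by simp
    moreover have "c j (\<phi> j \<one>) = s"
      using interval_hom_const[OF comp[unfolded U_def] _ _ j i] unfolding s_def by simp
    ultimately show ?thesis using x by simp
  qed
  then have "inv s \<otimes> c j (\<phi> j x) = x" if "j \<in> {lo V..hi V}" "x \<in> carrier R" for j x
    using that s by (simp add: m_lcomm[of "inv s" x s] Units_closed)
  then have "left_inverse U \<phi> (\<lambda>i v. inv s \<otimes> c i v)"
    unfolding left_inverse_def U_def by simp
  moreover have "morphism R \<tau> V U (\<lambda>i v. inv s \<otimes> c i v)"
    using morphism_comp[OF c[unfolded U_def] interval_hom_scale[OF Units_inv_closed[OF s]]]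
    unfolding U_def .
  ultimately show ?thesis unfolding splits_def by blast
qed

text \<open>The two hypotheses on \<phi> do separate work: injectivity makes the summands met by
  \<phi> cover \<open>[p,q]\<close>, and nonsplitting keeps \<open>[p,q]\<close> itself from being
  one of these intervals.\<close>

lemma nonsplit_monomorphism_iff_breaker_chain:
  fixes V :: "('a, 'v) zigzag"
  defines "U \<equiv> interval_module R (lo V) (hi V) (lo V) (hi V)"
  assumes V: "zigzag_module R \<tau> V" and pq: "lo V \<le> hi V"
    and dec: "interval_decomposition R \<tau> V A J"
  shows "(\<exists>\<phi>. monomorphism R \<tau> U V \<phi> \<and> \<not> splits R \<tau> U V \<phi>) \<longleftrightarrow>
    contains_spanning_breaker_chain R \<tau> V A J (lo V) (hi V)"
proof -
  let ?p = "lo V" and ?q = "hi V"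
  let ?I = "interval_module R ?p ?q"
  have finA: "finite A" and J: "\<And>\<alpha>. \<alpha> \<in> A \<Longrightarrow> zigzag_submodule R \<tau> V (J \<alpha>)"
    using dec unfolding interval_decomposition_def by simp_all
  obtain b d e c where "\<forall>\<alpha>\<in>A. is_interval R \<tau> V (J \<alpha>) (b \<alpha>) (d \<alpha>) \<and>
      morphism R \<tau> (?I (b \<alpha>) (d \<alpha>)) V (e \<alpha>) \<and> morphism R \<tau> V (?I (b \<alpha>) (d \<alpha>)) (c \<alpha>)"
    and "\<forall>\<alpha>\<in>A. \<forall>\<beta>\<in>A. \<forall>i\<in>{lo V..hi V}. \<forall>x. x \<in> (if i \<in> {b \<beta>..d \<beta>} then carrier R else {\<zero>}) \<longrightarrow>
      c \<alpha> i (e \<beta> i x) = (if \<alpha> = \<beta> then x else \<zero>)"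
    and "\<forall>i\<in>{lo V..hi V}. \<forall>v\<in>carrier (space V i). (\<forall>\<alpha>\<in>A. c \<alpha> i v = \<zero>) \<longrightarrow> v = \<zero>\<^bsub>space V i\<^esub>"
    using interval_coordinates[OF V dec] by (elim exE conjE) (rule that)
  then have int: "\<And>\<alpha>. \<alpha> \<in> A \<Longrightarrow> is_interval R \<tau> V (J \<alpha>) (b \<alpha>) (d \<alpha>)"
    and e: "\<And>\<alpha>. \<alpha> \<in> A \<Longrightarrow> morphism R \<tau> (?I (b \<alpha>) (d \<alpha>)) V (e \<alpha>)"
    and c: "\<And>\<alpha>. \<alpha> \<in> A \<Longrightarrow> morphism R \<tau> V (?I (b \<alpha>) (d \<alpha>)) (c \<alpha>)"
    and ce: "\<And>\<alpha> \<beta> i x. \<lbrakk>\<alpha> \<in> A; \<beta> \<in> A; i \<in> {lo V..hi V};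
      x \<in> (if i \<in> {b \<beta>..d \<beta>} then carrier R else {\<zero>})\<rbrakk> \<Longrightarrow> c \<alpha> i (e \<beta> i x) = (if \<alpha> = \<beta> then x else \<zero>)"
    and c_inj: "\<And>i v. \<lbrakk>i \<in> {lo V..hi V}; v \<in> carrier (space V i); \<And>\<alpha>. \<alpha> \<in> A \<Longrightarrow> c \<alpha> i v = \<zero>\<rbrakk> \<Longrightarrow>
      v = \<zero>\<^bsub>space V i\<^esub>"
    by simp_all
  have rng: "?p \<le> b \<alpha> \<and> b \<alpha> \<le> d \<alpha> \<and> d \<alpha> \<le> ?q" if "\<alpha> \<in> A" for \<alpha>
    using int[OF that] unfolding is_interval_def by simp
  have chain: "contains_spanning_breaker_chain R \<tau> V A J ?p ?q \<longleftrightarrow>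
    (\<exists>as. 2 \<le> length as \<and> set as \<subseteq> A \<and> b (hd as) = ?p \<and> d (last as) = ?q \<and>
       successively (\<lambda>\<alpha> \<beta>. breaks \<tau> (b \<alpha>, d \<alpha>) (b \<beta>, d \<beta>)) as)"
    by (rule contains_spanning_breaker_chain_iff[OF V J int])
  show ?thesis
    unfolding chain
  proof
    assume "\<exists>\<phi>. monomorphism R \<tau> U V \<phi> \<and> \<not> splits R \<tau> U V \<phi>"
    then obtain \<phi> where \<phi>: "morphism R \<tau> U V \<phi>"
      and inj: "\<And>i. i \<in> {?p..?q} \<Longrightarrow> inj_on (\<phi> i) (carrier R)"
      and nonsplit: "\<not> splits R \<tau> U V \<phi>"
      unfolding monomorphism_def by (auto simp: U_def)
    have hom: "morphism R \<tau> (?I ?p ?q) (?I (b \<alpha>) (d \<alpha>)) (\<lambda>i x. c \<alpha> i (\<phi> i x))" if "\<alpha> \<in> A" for \<alpha>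
      using morphism_comp[OF \<phi> c[OF that]] unfolding U_def .
    \<comment> \<open>By linearity a component vanishes at a vertex as soon as it kills \<one>
      there.\<close>
    define S where "S = {\<alpha> \<in> A. \<exists>i\<in>{b \<alpha>..d \<alpha>}. c \<alpha> i (\<phi> i \<one>) \<noteq> \<zero>}"
    have SA: "S \<subseteq> A" and "finite S" using finA unfolding S_def by auto
    have cov: "\<exists>\<alpha>\<in>S. i \<in> {b \<alpha>..d \<alpha>}" if i: "i \<in> {?p..?q}" for i
    proof -
      have "\<phi> i \<zero> = \<zero>\<^bsub>space V i\<^esub>"
        using linear_map_zero[OF morphismD(3)[OF \<phi> i] _ zigzag_moduleD(1)[OF V i]]
          module_interval_space unfolding U_def by simp
      then have "\<phi> i \<one> \<noteq> \<zero>\<^bsub>space V i\<^esub>"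
        using inj_onD[OF inj[OF i], of \<one> \<zero>] by auto
      moreover have "\<phi> i \<one> \<in> carrier (space V i)"
        using morphism_closed[OF \<phi> i] i unfolding U_def by simp
      \<comment> \<open>Joint injectivity yields a nonzero coordinate, and a coordinate can be
        nonzero only on its own support, which therefore contains \<open>i\<close>.\<close>
      ultimately obtain \<alpha> where \<alpha>: "\<alpha> \<in> A" "c \<alpha> i (\<phi> i \<one>) \<noteq> \<zero>" using c_inj[OF i] by blast
      moreover have "c \<alpha> i (\<phi> i \<one>) \<in> (if i \<in> {b \<alpha>..d \<alpha>} then carrier R else {\<zero>})"
        using morphism_closed[OF hom[OF \<alpha>(1)], of i \<one>] i by simp
      ultimately have "i \<in> {b \<alpha>..d \<alpha>}" by (auto split: if_splits)
      then show ?thesis using \<alpha> unfolding S_def by blast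
    qed
    have ends: "b \<alpha> = ?p \<or> \<tau> (b \<alpha> - 1) = Backward" "d \<alpha> = ?q \<or> \<tau> (d \<alpha>) = Forward"
      if \<alpha>: "\<alpha> \<in> S" for \<alpha>
    proof -
      obtain i where "\<alpha> \<in> A" "i \<in> {b \<alpha>..d \<alpha>}" "c \<alpha> i (\<phi> i \<one>) \<noteq> \<zero>"
        using \<alpha> unfolding S_def by blast
      then show "b \<alpha> = ?p \<or> \<tau> (b \<alpha> - 1) = Backward" "d \<alpha> = ?q \<or> \<tau> (d \<alpha>) = Forward"
        using interval_hom_ends[OF hom _ _ _ _ one_closed, of \<alpha> i] rng by blast+
    qed
    have proper: "b \<alpha> \<noteq> ?p \<or> d \<alpha> \<noteq> ?q" if \<alpha>: "\<alpha> \<in> S" for \<alpha>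
    proof (rule ccontr)
      assume full: "\<not> (b \<alpha> \<noteq> ?p \<or> d \<alpha> \<noteq> ?q)"
      then have "morphism R \<tau> V U (c \<alpha>)" using c[of \<alpha>] SA \<alpha> unfolding U_def by auto
      moreover have "\<exists>i\<in>{?p..?q}. c \<alpha> i (\<phi> i \<one>) \<noteq> \<zero>"
        using \<alpha> full unfolding S_def by auto
      ultimately show False
        using splits_if_full_component[OF \<phi>[unfolded U_def]] nonsplit unfolding U_def by blast
    qed
    have rngS: "?p \<le> b \<alpha> \<and> b \<alpha> \<le> d \<alpha> \<and> d \<alpha> \<le> ?q" if "\<alpha> \<in> S" for \<alpha>
      using rng SA that by blast
    show "\<exists>as. 2 \<le> length as \<and> set as \<subseteq> A \<and> b (hd as) = ?p \<and> d (last as) = ?q \<and>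
        successively (\<lambda>\<alpha> \<beta>. breaks \<tau> (b \<alpha>, d \<alpha>) (b \<beta>, d \<beta>)) as"
      using cover_contains_breaking_chain[of ?p ?q S b d \<tau>, OF pq \<open>finite S\<close> cov rngS ends proper] SA
      by (blast intro: subset_trans)
  next
    assume "\<exists>as. 2 \<le> length as \<and> set as \<subseteq> A \<and> b (hd as) = ?p \<and> d (last as) = ?q \<and>
        successively (\<lambda>\<alpha> \<beta>. breaks \<tau> (b \<alpha>, d \<alpha>) (b \<beta>, d \<beta>)) as"
    then obtain as where as: "2 \<le> length as" "set as \<subseteq> A" "b (hd as) = ?p" "d (last as) = ?q"
      "successively (\<lambda>\<alpha> \<beta>. breaks \<tau> (b \<alpha>, d \<alpha>) (b \<beta>, d \<beta>)) as" by blast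
    note props = breaking_chain_properties[OF as(1,5)]
    have ends: "b \<alpha> = ?p \<or> \<tau> (b \<alpha> - 1) = Backward" "d \<alpha> = ?q \<or> \<tau> (d \<alpha>) = Forward"
      if "\<alpha> \<in> set as" for \<alpha>
      using props[OF that] as(3,4) by auto
    have proper: "b \<alpha> \<noteq> ?p \<or> d \<alpha> \<noteq> ?q" if "\<alpha> \<in> set as" for \<alpha>
      using props[OF that] as(3,4) by auto
    have rng': "?p \<le> b \<alpha> \<and> b \<alpha> \<le> d \<alpha> \<and> d \<alpha> \<le> ?q" if "\<alpha> \<in> set as" for \<alpha>
      using rng as(2) that by blast
    obtain \<phi> where \<phi>: "morphism R \<tau> U V \<phi>"
      and c\<phi>: "\<forall>\<alpha>\<in>A. \<forall>i\<in>{?p..?q}. \<forall>x\<in>carrier R.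
       c \<alpha> i (\<phi> i x) = (if \<alpha> \<in> set as \<and> i \<in> {b \<alpha>..d \<alpha>} then x else \<zero>)"
      and \<rho>\<phi>: "\<forall>\<rho>. morphism R \<tau> V U \<rho> \<longrightarrow>
       (\<forall>i\<in>{?p..?q}. \<forall>x\<in>carrier R. \<rho> i (\<phi> i x) = \<zero>)"
      using morphism_into_proper_summands[where b=b and d=d, OF V e c ce finite_set as(2) rng' ends proper]
      unfolding U_def by blast
    have "inj_on (\<phi> i) (carrier R)" if i: "i \<in> {?p..?q}" for i
    proof -
      have "as \<noteq> []" using as(1) by auto
      then obtain \<alpha> where "\<alpha> \<in> set as" "i \<in> {b \<alpha>..d \<alpha>}"
        using breaking_chain_covers[OF _ as(5), of i] as(3,4) i by auto
      \<comment> \<open>The coordinate of a member through \<open>i\<close> inverts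
        \<open>\<phi> i\<close>. Which member serves depends on \<open>i\<close>, so this produces
        no retraction.\<close>
      then have "c \<alpha> i (\<phi> i x) = x" if "x \<in> carrier R" for x
        using c\<phi> as(2) i that by auto
      then show ?thesis by (metis inj_onI)
    qed
    then have "monomorphism R \<tau> U V \<phi>"
      using \<phi> unfolding monomorphism_def by (simp add: U_def)
    moreover have "\<not> splits R \<tau> U V \<phi>"
    proof
      assume "splits R \<tau> U V \<phi>"
      then obtain \<rho> where \<rho>: "morphism R \<tau> V U \<rho>" "left_inverse U \<phi> \<rho>"
        unfolding splits_def by blast
      \<comment> \<open>Any vertex would do for the contradiction; \<open>p\<close> is one because
        \<open>p \<le> q\<close>.\<close>
      have "\<rho> ?p (\<phi> ?p \<one>) = \<one>"
        using \<rho>(2)[unfolded left_inverse_def U_def, rule_format, of ?p \<one>] pq by simp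
      moreover have "\<rho> ?p (\<phi> ?p \<one>) = \<zero>" using \<rho>\<phi> \<rho>(1) pq by simp
      ultimately show False by simp
    qed
    ultimately show "\<exists>\<phi>. monomorphism R \<tau> U V \<phi> \<and> \<not> splits R \<tau> U V \<phi>" by blast
  qed
qed

end

theorem corollary3p18:
  fixes K :: "('k, 'r) ring_scheme"
    and \<tau> :: "nat \<Rightarrow> direction"
    and V Vpq :: "('k, 'v) zigzag"
    and U :: "('k, 'k) zigzag"
    and A :: "'a set"
    and J :: "'a \<Rightarrow> nat \<Rightarrow> 'v set"
    and n p q :: nat
  assumes "field K"
    and "zigzag_module K \<tau> V" and "lo V = 1" and "hi V = n"
    and "1 \<le> p" and "p \<le> q" and "q \<le> n"
    and "Vpq = restriction V p q"
    and "U = interval_module K p q p q"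
    and "interval_decomposition K \<tau> Vpq A J"
  shows
    "((\<forall>\<phi>. monomorphism K \<tau> U Vpq \<phi> \<longrightarrow> splits K \<tau> U Vpq \<phi>) \<longleftrightarrow>
        \<not> contains_spanning_breaker_chain K \<tau> Vpq A J p q) \<and>
     ((\<exists>\<phi>. monomorphism K \<tau> U Vpq \<phi> \<and> splits K \<tau> U Vpq \<phi>) \<and>
        (\<exists>\<phi>. monomorphism K \<tau> U Vpq \<phi> \<and> \<not> splits K \<tau> U Vpq \<phi>) \<longleftrightarrow>
        has_summand_isomorphic_to K \<tau> Vpq U \<and>
        contains_spanning_breaker_chain K \<tau> Vpq A J p q) \<and>
     ((\<exists>\<phi>. monomorphism K \<tau> U Vpq \<phi>) \<and>
        (\<forall>\<phi>. monomorphism K \<tau> U Vpq \<phi> \<longrightarrow> \<not> splits K \<tau> U Vpq \<phi>) \<longleftrightarrow>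
        contains_spanning_breaker_chain K \<tau> Vpq A J p q \<and>
        \<not> has_summand_isomorphic_to K \<tau> Vpq U)"
proof -
  interpret field K by fact
  have lohi: "lo Vpq = p" "hi Vpq = q" using assms(8) unfolding restriction_def by simp_all
  \<comment> \<open>Spaces and arrows are kept and the range of vertices only shrinks.\<close>
  have Vpq: "zigzag_module K \<tau> Vpq"
    using assms(2-8) unfolding zigzag_module_def restriction_def by simp
  have "(\<exists>\<phi>. monomorphism K \<tau> U Vpq \<phi> \<and> \<not> splits K \<tau> U Vpq \<phi>) \<longleftrightarrow>
      contains_spanning_breaker_chain K \<tau> Vpq A J p q"
    using nonsplit_monomorphism_iff_breaker_chain[OF Vpq _ assms(10)] assms(6,9) lohi by simp
  moreover have "(\<exists>\<phi>. monomorphism K \<tau> U Vpq \<phi> \<and> splits K \<tau> U Vpq \<phi>) \<longleftrightarrow>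
      has_summand_isomorphic_to K \<tau> Vpq U"
    using split_monomorphism_iff_summand[OF Vpq] interval_zigzag_module assms(9) by blast
  \<comment> \<open>All three parts are propositional consequences of the two equivalences: a
    monomorphism exists iff a splitting or a nonsplitting one does.\<close>
  ultimately show ?thesis by blast
qed

end
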